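(* Let $G=(V,E)$ be a finite (or infinite) graph, let $R>0$ and fix $x_0\in V$. Let $u:V\times\mathbb R\to\mathbb R^+$ be a positive function such that $\partial_tu(x,t)=\Delta u(x,t)$ whenever $d(x,x_0)\le 2R$. Suppose $G$ satisfies the exponential curvature dimension inequality $CDE(n,-K)$ with $K\ge0$. Let $a:(0,\infty)\to(0,\infty)$ be a $C^1$ function such that (A1) for all $t>0$, $a(t)>0$ and $a'(t)>0$, and $\lim_{t\to0}a(t)=0$, $\lim_{t\to 0}\frac{a(t)}{a'(t)}=0$; (A2) for any $L>0$, $\frac{a'^2}{a}$ is continuous and integrable on the interval $[0,L]$. Define $$\alpha(t)=1+\frac{2K}{a(t)}\int_0^t a(s)\,ds,\qquad \varphi(t)=nK+\frac{nK^2}{a(t)}\int_0^t a(s)\,ds+\frac{n}{4a(t)}\int_0^t\frac{a'(s)^2}{a(s)}\,ds .$$ Suppose that $\beta$ is a positive function satisfying, for all $t>0$, $$\frac{\beta'(t)}{\beta(t)}\le\frac{1}{\alpha^2(t)a^2(t)}\left(2K\alpha(t)a'(t)\int_0^ta(s)\,ds+\frac{a(t)}{2}\int_0^t\frac{a'(s)^2}{a(s)}\,ds-2K^2a(t)\int_0^ta(s)\,ds\right),$$ and that $\eta$ is a finite, positive function such that for every $T>0$, $\beta(t)\le\eta(T)$ holds for all $0<t\le T$. Then for $t>0$, $$\frac{\Gamma(\sqrt u)}{u}-\alpha(t)\frac{\partial_t(\sqrt u)}{\sqrt u}-\frac12\varphi(t)\le\frac{nD_\mu(1+D_\omega)\alpha^2(t)\eta(t)}{R\,\beta(t)}$$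 holds at every vertex of the ball of radius $R$ around $x_0$. Letting $R\to\infty$ (when $u$ solves the heat equation on all of $V$) gives $\frac{\Gamma(\sqrt u)}{u}-\alpha(t)\frac{\partial_t(\sqrt u)}{\sqrt u}\le\frac12\varphi(t)$.
   Context: $G=(V,E)$ is a graph with positive edge weights $\omega_{xy}>0$ for $x\sim y$, $\mu:V\to(0,\infty)$ is a measure on $V$, and $\deg(x)=\sum_{y\sim x}\omega_{xy}$; $d$ is the graph distance. Standing assumptions: $\omega_{min}:=\inf_{e\in E}\omega_e>0$, $D_\omega:=\max_{x\sim y}\frac{\deg(x)}{\omega_{xy}}<\infty$, $D_\mu:=\max_{x\in V}\frac{\deg(x)}{\mu(x)}<\infty$. The $\mu$-Laplacian is $\Delta f(x)=\frac1{\mu(x)}\sum_{y\sim x}\omega_{xy}(f(y)-f(x))$. The gradient form is $\Gamma(f,g)(x)=\frac{1}{2\mu(x)}\sum_{y\sim x}\omega_{xy}(f(y)-f(x))(g(y)-g(x))$, and $\Gamma(f)=\Gamma(f,f)$. For a positive function $f$ put $\widetilde\Gamma_2(f)=\frac12\Delta\Gamma(f)-\Gamma\left(f,\frac{\Delta(f^2)}{2f}\right)$. $G$ satisfies $CDE(n,K')$ (with $K'\in\mathbb R$) if for every vertex $x\in V$ and every positive $f:V\to\mathbb R$ with $\Delta f(x)<0$ one has, at $x$, $\widetilde\Gamma_2(f)\ge\frac1n(\Delta f)^2+K'\,\Gamma(f)$. *)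

theory Defs
  imports "HOL-Analysis.Analysis"
begin

text \<open>
  The vertex set \<open>V\<close> is the whole type \<open>'a\<close>, the edges are given by a symmetric relation \<open>adj\<close>,
  and \<open>w x y\<close> is meaningful only if \<open>adj x y\<close>.  Loops are not excluded: they contribute to
  \<open>wdeg\<close>, but not to the Laplacian or to the gradient form.
\<close>

definition wdeg :: "('a \<Rightarrow> 'a \<Rightarrow> bool) \<Rightarrow> ('a \<Rightarrow> 'a \<Rightarrow> real) \<Rightarrow> 'a \<Rightarrow> real" where
  "wdeg adj w x = (\<Sum>y | adj x y. w x y)"

text \<open>
  The standing assumptions.  \<open>weight_lower\<close> says that the infimum of the edge weights is positive
  (and holds vacuously without edges); \<open>deg_weight_bounded\<close> and \<open>deg_measure_bounded\<close> say that
  \<open>D_omega\<close> and \<open>D_mu\<close> below are finite.  Local finiteness follows mathematically from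
  \<open>weight_lower\<close> and the finiteness of all degrees, but it has to be required explicitly because
  \<open>sum\<close> is \<open>0\<close> on infinite index sets.
\<close>

locale weighted_graph =
  fixes adj :: "'a \<Rightarrow> 'a \<Rightarrow> bool"
    and w :: "'a \<Rightarrow> 'a \<Rightarrow> real"
    and \<mu> :: "'a \<Rightarrow> real"
  assumes adj_sym: "adj x y \<Longrightarrow> adj y x"
    and locally_finite: "finite {y. adj x y}"
    and weight_pos: "adj x y \<Longrightarrow> w x y > 0"
    and weight_sym: "adj x y \<Longrightarrow> w x y = w y x"
    and measure_pos: "\<mu> x > 0"
    and weight_lower: "\<exists>c>0. \<forall>x y. adj x y \<longrightarrow> c \<le> w x y"
    and deg_weight_bounded: "bdd_above {wdeg adj w x / w x y | x y. adj x y}"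
    and deg_measure_bounded: "bdd_above (range (\<lambda>x. wdeg adj w x / \<mu> x))"

text \<open>
  Without edges the value of \<open>D_omega\<close> is an unspecified real number; in that case \<open>D_mu\<close> is \<open>0\<close>,
  so the product of \<open>D_mu\<close> and \<open>1 + D_omega\<close> is still \<open>0\<close>.
\<close>

definition D_omega :: "('a \<Rightarrow> 'a \<Rightarrow> bool) \<Rightarrow> ('a \<Rightarrow> 'a \<Rightarrow> real) \<Rightarrow> real" where
  "D_omega adj w = Sup {wdeg adj w x / w x y | x y. adj x y}"

definition D_mu ::
  "('a \<Rightarrow> 'a \<Rightarrow> bool) \<Rightarrow> ('a \<Rightarrow> 'a \<Rightarrow> real) \<Rightarrow> ('a \<Rightarrow> real) \<Rightarrow> real" where
  "D_mu adj w \<mu> = (SUP x. wdeg adj w x / \<mu> x)"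

text \<open>
  \<open>(adj ^^ k) x y\<close> says that there is a walk of length \<open>k\<close> from \<open>x\<close> to \<open>y\<close>; vertices in different
  connected components are at distance \<open>\<infinity>\<close>.
\<close>

definition graph_dist :: "('a \<Rightarrow> 'a \<Rightarrow> bool) \<Rightarrow> 'a \<Rightarrow> 'a \<Rightarrow> enat" where
  "graph_dist adj x y = (INF k \<in> {k. (adj ^^ k) x y}. enat k)"

definition graph_cball :: "('a \<Rightarrow> 'a \<Rightarrow> bool) \<Rightarrow> 'a \<Rightarrow> real \<Rightarrow> 'a set" where
  "graph_cball adj x\<^sub>0 r = {x. ereal_of_enat (graph_dist adj x x\<^sub>0) \<le> ereal r}"

definition laplacian ::
  "('a \<Rightarrow> 'a \<Rightarrow> bool) \<Rightarrow> ('a \<Rightarrow> 'a \<Rightarrow> real) \<Rightarrow> ('a \<Rightarrow> real) \<Rightarrow> ('a \<Rightarrow> real) \<Rightarrow> 'a \<Rightarrow> real" where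
  "laplacian adj w \<mu> f x = (1 / \<mu> x) * (\<Sum>y | adj x y. w x y * (f y - f x))"

definition gradient_form ::
  "('a \<Rightarrow> 'a \<Rightarrow> bool) \<Rightarrow> ('a \<Rightarrow> 'a \<Rightarrow> real) \<Rightarrow> ('a \<Rightarrow> real) \<Rightarrow>
    ('a \<Rightarrow> real) \<Rightarrow> ('a \<Rightarrow> real) \<Rightarrow> 'a \<Rightarrow> real" where
  "gradient_form adj w \<mu> f g x =
     (1 / (2 * \<mu> x)) * (\<Sum>y | adj x y. w x y * (f y - f x) * (g y - g x))"

definition Gamma2_tilde ::
  "('a \<Rightarrow> 'a \<Rightarrow> bool) \<Rightarrow> ('a \<Rightarrow> 'a \<Rightarrow> real) \<Rightarrow> ('a \<Rightarrow> real) \<Rightarrow> ('a \<Rightarrow> real) \<Rightarrow> 'a \<Rightarrow> real" where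
  "Gamma2_tilde adj w \<mu> f x =
     1/2 * laplacian adj w \<mu> (gradient_form adj w \<mu> f f) x
     - gradient_form adj w \<mu> f (\<lambda>y. laplacian adj w \<mu> (\<lambda>z. (f z)\<^sup>2) y / (2 * f y)) x"

definition CDE ::
  "('a \<Rightarrow> 'a \<Rightarrow> bool) \<Rightarrow> ('a \<Rightarrow> 'a \<Rightarrow> real) \<Rightarrow> ('a \<Rightarrow> real) \<Rightarrow> real \<Rightarrow> real \<Rightarrow> bool" where
  "CDE adj w \<mu> n K' \<longleftrightarrow>
     (\<forall>x f. (\<forall>y. f y > 0) \<longrightarrow> laplacian adj w \<mu> f x < 0 \<longrightarrow>
        Gamma2_tilde adj w \<mu> f x
          \<ge> 1/n * (laplacian adj w \<mu> f x)\<^sup>2 + K' * gradient_form adj w \<mu> f f x)"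

definition alpha :: "real \<Rightarrow> (real \<Rightarrow> real) \<Rightarrow> real \<Rightarrow> real" where
  "alpha K a t = 1 + 2 * K / a t * integral {0..t} a"

definition phi :: "real \<Rightarrow> real \<Rightarrow> (real \<Rightarrow> real) \<Rightarrow> real \<Rightarrow> real" where
  "phi n K a t = n * K + n * K\<^sup>2 / a t * integral {0..t} a
     + n / (4 * a t) * integral {0..t} (\<lambda>s. (deriv a s)\<^sup>2 / a s)"

end

theory Submission
  imports Defs "HOL-Real_Asymp.Real_Asymp"
begin

text \<open>
  Write \<open>H = 2 \<Gamma>(\<surd>u)/u - \<alpha> \<Delta>u/u - \<phi>\<close>. A maximum principle for \<open>\<psi> H / \<alpha>\<^sup>2\<close>, with \<open>\<psi>\<close> the linear
  cutoff, gives \<open>\<psi> H \<le> 2 n D\<^sub>\<mu> (1 + D\<^sub>\<omega>) \<alpha>\<^sup>2 / R\<close>: the equations for \<open>\<alpha>\<close> and \<open>\<phi>\<close> turn the part of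
  the curvature inequality that is free of \<open>H\<close> into a complete square. This argument needs \<open>\<alpha>\<close> to be
  nondecreasing, which fails for general weights \<open>a\<close>.

  However, for a fixed time \<open>T\<close> the numbers \<open>\<alpha>(T)\<close> and \<open>\<phi>(T)\<close> depend on \<open>a = b\<^sup>2\<close> only through
  \<open>\<integral> b\<^sup>2 / b(T)\<^sup>2\<close> and \<open>\<integral> b'\<^sup>2 / b(T)\<^sup>2\<close> over \<open>[0, T]\<close>. For a given value of the first, the second
  is minimal if \<open>b'' = \<lambda> b\<close>, \<open>b(0) = 0\<close>, that is, if \<open>b\<close> is a multiple of \<open>sin\<close>, \<open>sinh\<close> or the
  identity. Such weights are log-concave, and then \<open>\<alpha>\<close> is nondecreasing. So the estimate for
  this optimal weight implies the one for \<open>a\<close>. The function \<open>\<beta>\<close> only enters through \<open>\<beta> \<le> \<eta>\<close>.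
\<close>

section \<open>Estimates on weighted graphs\<close>

context weighted_graph
begin

abbreviation Lap :: "('a \<Rightarrow> real) \<Rightarrow> 'a \<Rightarrow> real" where
  "Lap \<equiv> laplacian adj w \<mu>"

abbreviation Gam :: "('a \<Rightarrow> real) \<Rightarrow> ('a \<Rightarrow> real) \<Rightarrow> 'a \<Rightarrow> real" where
  "Gam \<equiv> gradient_form adj w \<mu>"

abbreviation "Dmu \<equiv> D_mu adj w \<mu>"
abbreviation "Dom \<equiv> D_omega adj w"

section \<open>Degrees and the constants \<open>Dmu\<close> and \<open>Dom\<close>\<close>

lemma wdeg_nonneg: "0 \<le> wdeg adj w x"
  unfolding wdeg_def by (intro sum_nonneg) (auto intro: less_imp_le weight_pos)

lemma weight_le_wdeg: "adj x y \<Longrightarrow> w x y \<le> wdeg adj w x"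
  unfolding wdeg_def
  by (rule member_le_sum) (auto intro: less_imp_le weight_pos locally_finite)

lemma wdeg_le_D_mu: "wdeg adj w x / \<mu> x \<le> Dmu"
  unfolding D_mu_def by (rule cSUP_upper[OF _ deg_measure_bounded]) simp

lemma D_mu_nonneg: "0 \<le> Dmu"
  using wdeg_le_D_mu[of undefined] wdeg_nonneg[of undefined] measure_pos[of undefined]
  by (meson divide_nonneg_pos order_trans)

lemma wdeg_le_D_omega:
  assumes "adj x y"
  shows "wdeg adj w x \<le> Dom * w x y"
proof -
  have "wdeg adj w x / w x y \<le> Dom"
    unfolding D_omega_def using assms by (intro cSup_upper deg_weight_bounded) blast
  then show ?thesis
    using weight_pos[OF assms] by (simp add: field_simps)
qed

lemma D_omega_ge_1:
  assumes "adj x y"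
  shows "1 \<le> Dom"
proof -
  have "1 * w x y \<le> Dom * w x y"
    using weight_le_wdeg[OF assms] wdeg_le_D_omega[OF assms] by simp
  then show ?thesis
    using weight_pos[OF assms] mult_le_cancel_right_pos by blast
qed

text \<open>Stands in for \<open>1 \<le> Dom\<close>, which requires an edge: without edges
  \<open>Dom\<close> is the supremum of the empty set, but then \<open>Dmu = 0\<close>.\<close>

lemma D_mu_le_D_mu_D_omega: "Dmu \<le> Dmu * Dom"
proof (cases "\<exists>x y. adj x y")
  case True
  then show ?thesis
    using D_omega_ge_1 D_mu_nonneg by (metis mult.right_neutral mult_left_mono)
next
  case False
  then have "Dmu = 0" by (simp add: D_mu_def wdeg_def)
  then show ?thesis by simp
qed

text \<open>Comes from \<open>B\<^sup>2 - A\<^sup>2 = 2 A (B - A) + (B - A)\<^sup>2\<close> on each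
  edge; on a graph this replaces the chain rule for the square.\<close>

lemma laplacian_square: "Lap (\<lambda>y. (f y)\<^sup>2) x = 2 * f x * Lap f x + 2 * Gam f f x"
proof -
  have "(\<Sum>y | adj x y. w x y * ((f y)\<^sup>2 - (f x)\<^sup>2)) =
      2 * f x * (\<Sum>y | adj x y. w x y * (f y - f x))
      + (\<Sum>y | adj x y. w x y * (f y - f x) * (f y - f x))"
    unfolding sum_distrib_left sum.distrib[symmetric]
    by (intro sum.cong) (auto simp: power2_eq_square algebra_simps)
  then show ?thesis
    using measure_pos[of x] by (simp add: laplacian_def gradient_form_def field_simps)
qed

lemma gradient_form_nonneg: "0 \<le> Gam f f x"
proof -
  have "0 \<le> w x y * (f y - f x) * (f y - f x)" if "adj x y" for y
    using weight_pos[OF that] by (simp add: mult.assoc)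
  then show ?thesis
    unfolding gradient_form_def using measure_pos[of x]
    by (intro mult_nonneg_nonneg[OF _ sum_nonneg]) auto
qed

text \<open>Loops carry no difference quotients, so they are left out of this degree.\<close>

definition ldeg :: "'a \<Rightarrow> real" where
  "ldeg x = (1 / \<mu> x) * (\<Sum>y\<in>{y. adj x y} - {x}. w x y)"

lemma ldeg_nonneg: "0 \<le> ldeg x"
  unfolding ldeg_def using measure_pos[of x]
  by (intro mult_nonneg_nonneg sum_nonneg) (auto intro: less_imp_le weight_pos)

lemma ldeg_le_D_mu: "ldeg x \<le> Dmu"
proof -
  have "(\<Sum>y\<in>{y. adj x y} - {x}. w x y) \<le> wdeg adj w x"
    unfolding wdeg_def
    by (intro sum_mono2) (auto intro: less_imp_le weight_pos locally_finite)
  then have "ldeg x \<le> wdeg adj w x / \<mu> x"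
    using measure_pos[of x] by (simp add: ldeg_def divide_right_mono)
  then show ?thesis using wdeg_le_D_mu order_trans by blast
qed

lemma sum_neighbours_drop_loop:
  assumes "g x = (0::real)"
  shows "(\<Sum>y | adj x y. g y) = (\<Sum>y\<in>{y. adj x y} - {x}. g y)"
  using assms by (intro sum.mono_neutral_right) (auto intro: locally_finite)

lemma laplacian_ge:
  assumes "\<And>y. f y \<ge> 0"
  shows "- (ldeg x * f x) \<le> Lap f x"
proof -
  have "- (\<Sum>y\<in>{y. adj x y} - {x}. w x y * f x) \<le> (\<Sum>y\<in>{y. adj x y} - {x}. w x y * (f y - f x))"
    unfolding sum_negf[symmetric]
    by (intro sum_mono) (auto simp: algebra_simps intro: mult_nonneg_nonneg assms less_imp_le weight_pos)
  then have "(1 / \<mu> x) * (- (\<Sum>y\<in>{y. adj x y} - {x}. w x y * f x))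
      \<le> (1 / \<mu> x) * (\<Sum>y\<in>{y. adj x y} - {x}. w x y * (f y - f x))"
    using measure_pos[of x] by (intro mult_left_mono) auto
  then show ?thesis
    unfolding laplacian_def ldeg_def
    by (subst sum_neighbours_drop_loop) (auto simp: sum_distrib_right)
qed

text \<open>
  The curvature condition is tested on small perturbations of a constant by a point mass. In
  regions where the cutoff is below \<open>2 / R\<close> this bound replaces the maximum principle.
\<close>

lemma ldeg_le_CDE:
  assumes cde: "CDE adj w \<mu> n (- K)" and n: "n > 0" and K: "K \<ge> 0"
  shows "ldeg x \<le> n * (Dmu + K / 2)"
proof (cases "ldeg x = 0")
  case True
  then show ?thesis using D_mu_nonneg n K by simp
next
  case False
  define d where "d = ldeg x"
  \<comment> \<open>\<open>S\<close> collects the rates \<open>w y x / \<mu> y\<close> of stepping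
    back to \<open>x\<close>. A test function that is constant off \<open>x\<close> is felt at a
    neighbour only through this edge.\<close>
  define S where "S = (1 / \<mu> x) * (\<Sum>y\<in>{y. adj x y} - {x}. w x y * (w y x / \<mu> y))"
  have d: "d > 0" using False ldeg_nonneg[of x] by (simp add: d_def)
  have mx: "\<mu> x > 0" by (rule measure_pos)
  have sumw: "(\<Sum>y\<in>{y. adj x y} - {x}. w x y) = \<mu> x * d"
    using mx by (simp add: d_def ldeg_def)
  have sumS: "(\<Sum>y\<in>{y. adj x y} - {x}. w x y * (w y x / \<mu> y)) = \<mu> x * S"
    using mx by (simp add: S_def)
  have S_le: "S \<le> d * Dmu"
  proof -
    have "(\<Sum>y\<in>{y. adj x y} - {x}. w x y * (w y x / \<mu> y)) \<le> (\<Sum>y\<in>{y. adj x y} - {x}. w x y * Dmu)"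
    proof (intro sum_mono mult_left_mono)
      fix y assume y: "y \<in> {y. adj x y} - {x}"
      then have "w y x / \<mu> y \<le> wdeg adj w y / \<mu> y"
        using measure_pos[of y] by (auto intro!: divide_right_mono weight_le_wdeg[OF adj_sym])
      then show "w y x / \<mu> y \<le> Dmu" using wdeg_le_D_mu order_trans by blast
      show "0 \<le> w x y" using y by (auto intro: less_imp_le weight_pos)
    qed
    then have "\<mu> x * S \<le> \<mu> x * (d * Dmu)"
      unfolding sumS sum_distrib_right[symmetric] sumw by (simp add: mult.assoc)
    then show ?thesis using mx by simp
  qed
  \<comment> \<open>The test function is \<open>1 + e\<close> at \<open>x\<close> and
    \<open>1\<close> elsewhere; its Laplacian at \<open>x\<close> is negative, so the curvature
    condition applies. All terms are of order \<open>e\<^sup>2\<close>, and that factor is divided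
    out.\<close>
  have main: "d\<^sup>2 / n - K * d / 2 \<le> 3 / 4 * S + d\<^sup>2 / 4 + e * S / 4" if e: "e > 0" for e :: real
  proof -
    define f where "f = (\<lambda>y. if y = x then 1 + e else (1::real))"
    define h where "h = (\<lambda>y. Lap (\<lambda>z. (f z)\<^sup>2) y / (2 * f y))"
    have fx: "f x = 1 + e" by (simp add: f_def)
    have fy: "f y = 1" if "y \<noteq> x" for y using that by (simp add: f_def)
    have lapx: "Lap g x = d * k" if "\<And>y. y \<noteq> x \<Longrightarrow> g y - g x = k" for g k
    proof -
      have "(\<Sum>y | adj x y. w x y * (g y - g x)) = (\<Sum>y\<in>{y. adj x y} - {x}. w x y * k)"
        using that by (subst sum_neighbours_drop_loop) (auto intro!: sum.cong)
      then show ?thesis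
        using mx by (simp add: laplacian_def sumw sum_distrib_right[symmetric])
    qed
    have at_nb: "(\<Sum>z | adj y z. w y z * G z) = w y x * G x"
      if "adj x y" "\<And>z. z \<noteq> x \<Longrightarrow> G z = 0" for y G
    proof -
      have "(\<Sum>z | adj y z. w y z * G z) = (\<Sum>z\<in>{x}. w y z * G z)"
        using adj_sym[OF that(1)] that(2) by (intro sum.mono_neutral_right) (auto intro: locally_finite)
      then show ?thesis by simp
    qed
    have lap: "Lap f x = - (d * e)" by (subst lapx[of _ "- e"]) (auto simp: f_def)
    have gamx: "Gam f f x = e\<^sup>2 * d / 2"
    proof -
      have "(\<Sum>y | adj x y. w x y * (f y - f x) * (f y - f x)) = (\<Sum>y\<in>{y. adj x y} - {x}. w x y * e\<^sup>2)"
        by (subst sum_neighbours_drop_loop)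
           (auto intro!: sum.cong simp: fx fy power2_eq_square)
      then show ?thesis
        using mx by (simp add: gradient_form_def sumw sum_distrib_right[symmetric])
    qed
    have gamy: "Gam f f y = e\<^sup>2 / 2 * (w y x / \<mu> y)" if "y \<in> {y. adj x y} - {x}" for y
    proof -
      have "(\<Sum>z | adj y z. w y z * ((f z - f y) * (f z - f y))) = w y x * ((f x - f y) * (f x - f y))"
        using that by (intro at_nb) (auto simp: fy)
      moreover have "f y = 1" using that by (simp add: fy)
      ultimately show ?thesis
        unfolding gradient_form_def mult.assoc by (simp add: fx power2_eq_square)
    qed
    have hx: "h x = - (d * (2 * e + e\<^sup>2) / (2 * (1 + e)))"
    proof -
      have "Lap (\<lambda>z. (f z)\<^sup>2) x = d * (- (2 * e + e\<^sup>2))"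
        by (rule lapx) (simp add: fx fy power2_eq_square algebra_simps)
      then show ?thesis by (simp only: h_def fx mult_minus_right minus_divide_left)
    qed
    have hy: "h y = (2 * e + e\<^sup>2) / 2 * (w y x / \<mu> y)" if "y \<in> {y. adj x y} - {x}" for y
    proof -
      have "(\<Sum>z | adj y z. w y z * ((f z)\<^sup>2 - (f y)\<^sup>2)) = w y x * ((f x)\<^sup>2 - (f y)\<^sup>2)"
        using that by (intro at_nb) (auto simp: fy)
      moreover have "f y = 1" using that by (simp add: fy)
      ultimately show ?thesis
        unfolding h_def laplacian_def by (simp add: fx power2_eq_square algebra_simps)
    qed
    have 1: "Lap (Gam f f) x = e\<^sup>2 / 2 * (S - d\<^sup>2)"
    proof -
      have "(\<Sum>y | adj x y. w x y * (Gam f f y - Gam f f x)) =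
          (\<Sum>y\<in>{y. adj x y} - {x}. e\<^sup>2 / 2 * (w x y * (w y x / \<mu> y)) - e\<^sup>2 * d / 2 * w x y)"
        by (subst sum_neighbours_drop_loop)
           (auto intro!: sum.cong simp: gamx gamy algebra_simps)
      also have "\<dots> = e\<^sup>2 / 2 * (\<mu> x * S) - e\<^sup>2 * d / 2 * (\<mu> x * d)"
        unfolding sum_subtractf sum_distrib_left[symmetric] sumS sumw ..
      finally show ?thesis
        unfolding laplacian_def using mx by (simp add: field_simps power2_eq_square)
    qed
    have 2: "Gam f h x = - (e / 2 * ((2 * e + e\<^sup>2) / 2 * S + d * (d * (2 * e + e\<^sup>2) / (2 * (1 + e)))))"
    proof -
      have "(\<Sum>y | adj x y. w x y * (f y - f x) * (h y - h x)) =
          (\<Sum>y\<in>{y. adj x y} - {x}. (- e * (2 * e + e\<^sup>2) / 2) * (w x y * (w y x / \<mu> y)) + (e * h x) * w x y)"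
        by (subst sum_neighbours_drop_loop)
           (auto intro!: sum.cong simp: fx fy hy algebra_simps)
      also have "\<dots> = (- e * (2 * e + e\<^sup>2) / 2) * (\<mu> x * S) + (e * h x) * (\<mu> x * d)"
        unfolding sum.distrib sum_distrib_left[symmetric] sumS sumw ..
      also have "\<dots> = \<mu> x * ((- e * (2 * e + e\<^sup>2) / 2) * S + (e * h x) * d)"
        by (simp only: distrib_left mult.left_commute mult.assoc)
      finally have eq: "(\<Sum>y | adj x y. w x y * (f y - f x) * (h y - h x)) =
          \<mu> x * ((- e * (2 * e + e\<^sup>2) / 2) * S + (e * h x) * d)" .
      show ?thesis
        unfolding gradient_form_def eq unfolding hx using mx by (simp add: field_simps)
    qed
    have "Gamma2_tilde adj w \<mu> f x \<ge> 1/n * (Lap f x)\<^sup>2 + (- K) * Gam f f x"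
      using cde[unfolded CDE_def, rule_format, of f x] lap d e by (auto simp: f_def)
    then have "1/n * (d * e)\<^sup>2 - K * (e\<^sup>2 * d / 2) \<le> e\<^sup>2 / 4 * (S - d\<^sup>2)
        + (e / 2 * ((2 * e + e\<^sup>2) / 2 * S + d * (d * (2 * e + e\<^sup>2) / (2 * (1 + e)))))"
      unfolding Gamma2_tilde_def h_def[symmetric] 1 2 gamx lap by simp
    also have "\<dots> \<le> e\<^sup>2 / 4 * (S - d\<^sup>2) + (e / 2 * ((2 * e + e\<^sup>2) / 2 * S + d * (d * e)))"
    proof -
      have "(2 * e + e\<^sup>2) / (2 * (1 + e)) \<le> e"
        using e by (simp add: field_simps power2_eq_square)
      then have "d * (2 * e + e\<^sup>2) / (2 * (1 + e)) \<le> d * e"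
        using d by (metis less_imp_le mult_left_mono times_divide_eq_right)
      then show ?thesis using d e by (intro add_left_mono mult_left_mono) auto
    qed
    also have "\<dots> = e\<^sup>2 * (3 / 4 * S + d\<^sup>2 / 4 + e * S / 4)"
      by (simp add: field_simps power2_eq_square)
    also have "1 / n * (d * e)\<^sup>2 - K * (e\<^sup>2 * d / 2) = e\<^sup>2 * (d\<^sup>2 / n - K * d / 2)"
      by (simp add: algebra_simps power_mult_distrib)
    finally have "e\<^sup>2 * (d\<^sup>2 / n - K * d / 2) \<le> e\<^sup>2 * (3 / 4 * S + d\<^sup>2 / 4 + e * S / 4)" .
    then show ?thesis using e by simp
  qed
  have "d\<^sup>2 / n - K * d / 2 \<le> 3 / 4 * S + d\<^sup>2 / 4"
  proof (rule tendsto_lowerbound)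
    show "((\<lambda>e. 3 / 4 * S + d\<^sup>2 / 4 + e * S / 4) \<longlongrightarrow> 3 / 4 * S + d\<^sup>2 / 4) (at_right 0)"
      by (auto intro!: tendsto_eq_intros)
    show "\<forall>\<^sub>F e in at_right 0. d\<^sup>2 / n - K * d / 2 \<le> 3 / 4 * S + d\<^sup>2 / 4 + e * S / 4"
      using main by (auto simp: eventually_at_filter)
  qed simp
  \<comment> \<open>\<open>S\<close> and \<open>d\<^sup>2\<close> have the same bound
    \<open>d * Dmu\<close>, and their coefficients add up to \<open>1\<close>.\<close>
  also have "\<dots> \<le> 3 / 4 * (d * Dmu) + d * Dmu / 4"
  proof -
    have "d\<^sup>2 \<le> d * Dmu"
      using ldeg_le_D_mu[of x] d by (simp add: d_def power2_eq_square mult_left_mono)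
    with S_le show ?thesis by linarith
  qed
  finally have "d * (d / n - K / 2) \<le> d * Dmu"
    by (simp add: algebra_simps power2_eq_square)
  then have "d / n \<le> Dmu + K / 2" using d by simp
  then show ?thesis using n by (simp add: d_def field_simps)
qed

end

section \<open>Optimal weights\<close>

lemma nonneg_of_deriv:
  fixes g g' :: "real \<Rightarrow> real"
  assumes "\<And>s. (g has_real_derivative g' s) (at s)" "\<And>s. 0 < s \<Longrightarrow> s < t \<Longrightarrow> 0 \<le> g' s" "g 0 = 0" "0 \<le> t"
  shows "0 \<le> g t"
proof -
  have "g 0 \<le> g t"
    using assms(4)
  proof (rule DERIV_nonneg_imp_increasing_open)
    show "continuous_on {0..t} g"
      using assms(1) by (meson DERIV_isCont continuous_at_imp_continuous_on)
  qed (use assms in blast)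
  then show ?thesis using assms by simp
qed

lemma const_of_deriv:
  fixes g :: "real \<Rightarrow> real"
  assumes "\<And>s. (g has_real_derivative 0) (at s)"
  shows "g t = g 0"
  using assms DERIV_isconst_all by blast

text \<open>Solutions of \<open>b'' = lam b\<close>, with \<open>c = b'\<close> and \<open>A\<close>
  the integral of \<open>b\<^sup>2\<close> from \<open>0\<close>. The derivatives exist on the whole
  line, so monotonicity arguments can start at \<open>0\<close> itself.\<close>

locale oscillator =
  fixes lam S :: real and b c A :: "real \<Rightarrow> real"
  assumes db: "\<And>t. (b has_real_derivative c t) (at t)"
    and dc: "\<And>t. (c has_real_derivative lam * b t) (at t)"
    and dA: "\<And>t. (A has_real_derivative (b t)\<^sup>2) (at t)"
    and b0: "b 0 = 0" and c0: "c 0 = 1" and A0: "A 0 = 0"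
    and b_pos: "\<And>t. 0 < t \<Longrightarrow> t < S \<Longrightarrow> b t > 0"
begin

text \<open>Conservation of energy: the derivative \<open>2 c lam b - 2 lam b c\<close>
  vanishes.\<close>

lemma c_square: "(c t)\<^sup>2 - lam * (b t)\<^sup>2 = 1"
  by (subst const_of_deriv[where g="\<lambda>t. (c t)\<^sup>2 - lam * (b t)\<^sup>2"])
     (auto intro!: derivative_eq_intros db dc simp: b0 c0)

text \<open>The difference of the two sides has derivative
  \<open>c\<^sup>2 - lam b\<^sup>2 - 1\<close>, which is zero by \<open>c_square\<close>.\<close>

lemma bc_eq: "b t * c t - 2 * lam * A t = t"
proof -
  have "b t * c t - 2 * lam * A t - t = b 0 * c 0 - 2 * lam * A 0 - 0"
  proof (rule const_of_deriv)
    fix s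
    have "lam * b s * b s + c s * c s - 2 * lam * (b s)\<^sup>2 - 1 = 0"
      using c_square[of s] by (simp add: power2_eq_square algebra_simps)
    then show "((\<lambda>t. b t * c t - 2 * lam * A t - t) has_real_derivative 0) (at s)"
      by (auto intro!: derivative_eq_intros db dc dA simp: algebra_simps)
  qed
  then show ?thesis by (simp add: b0 A0)
qed

lemma A_nonneg: "0 \<le> t \<Longrightarrow> 0 \<le> A t"
  by (rule nonneg_of_deriv[OF dA]) (auto simp: A0)

text \<open>\<open>b c - lam A\<close> is the integral of \<open>c\<^sup>2\<close> from
  \<open>0\<close>, since the terms \<open>lam b\<^sup>2\<close> cancel in the derivative.\<close>

lemma energy_nonneg: "0 \<le> t \<Longrightarrow> 0 \<le> b t * c t - lam * A t"
proof (rule nonneg_of_deriv[where g="\<lambda>t. b t * c t - lam * A t" and g'="\<lambda>t. (c t)\<^sup>2"])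
  show "((\<lambda>a. b a * c a - lam * A a) has_real_derivative (c s)\<^sup>2) (at s)" for s
    by (auto intro!: derivative_eq_intros db dc dA simp: power2_eq_square algebra_simps)
qed (auto simp: b0 A0)

text \<open>The derivative of \<open>b ^ 3 - 2 c A\<close> is \<open>b (b c - 2 lam A)\<close>,
  which \<open>bc_eq\<close> turns into \<open>b t\<close>. This inequality is behind the
  monotonicity of \<alpha>.\<close>

lemma A_le: "0 \<le> t \<Longrightarrow> t < S \<Longrightarrow> 2 * c t * A t \<le> (b t) ^ 3"
proof -
  assume t: "0 \<le> t" "t < S"
  have "0 \<le> (b t) ^ 3 - 2 * c t * A t"
  proof (rule nonneg_of_deriv[where g="\<lambda>t. (b t) ^ 3 - 2 * c t * A t" and g'="\<lambda>t. b t * t"])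
    show "((\<lambda>t. b t ^ 3 - 2 * c t * A t) has_real_derivative b s * s) (at s)" for s
      apply (rule derivative_eq_intros db dc dA refl)+
      using bc_eq[of s] by (simp add: algebra_simps power2_eq_square) algebra
  qed (use t in \<open>auto simp: b0 A0 intro!: mult_nonneg_nonneg less_imp_le[OF b_pos]\<close>)
  then show ?thesis by simp
qed

text \<open>\<open>r\<close> is the logarithmic derivative of \<open>b\<close> and solves a Riccati
  equation. For the weight \<open>a = b\<^sup>2\<close>, \<open>I t\<close> is the quotient of the
  integral of \<open>a\<close> over \<open>{0..t}\<close> by \<open>a t\<close>.\<close>

definition r :: "real \<Rightarrow> real" where "r t = c t / b t"
definition I :: "real \<Rightarrow> real" where "I t = A t / (b t)\<^sup>2"

lemma dr: "0 < t \<Longrightarrow> t < S \<Longrightarrow> (r has_real_derivative lam - (r t)\<^sup>2) (at t)"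
  unfolding r_def using b_pos[of t]
  by (auto intro!: derivative_eq_intros db dc simp: field_simps power2_eq_square)

lemma dI: "0 < t \<Longrightarrow> t < S \<Longrightarrow> (I has_real_derivative 1 - 2 * r t * I t) (at t)"
  unfolding I_def r_def using b_pos[of t]
  by (auto intro!: derivative_eq_intros db dA simp: field_simps power2_eq_square)

lemma I_nonneg: "0 \<le> t \<Longrightarrow> 0 \<le> I t"
  by (simp add: I_def A_nonneg)

lemma dI_nonneg: "0 < t \<Longrightarrow> t < S \<Longrightarrow> 0 \<le> 1 - 2 * r t * I t"
  using A_le[of t] b_pos[of t]
  by (simp add: I_def r_def field_simps power2_eq_square power3_eq_cube)

text \<open>The difference is the integral of \<open>c\<^sup>2\<close> divided by
  \<open>b\<^sup>2\<close>, which up to the factor \<open>n\<close> is the last term of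
  \<open>phi\<close> for the weight \<open>b\<^sup>2\<close>.\<close>

lemma r_ge: "0 < t \<Longrightarrow> t < S \<Longrightarrow> 0 \<le> r t - lam * I t"
proof -
  assume t: "0 < t" "t < S"
  have "r t - lam * I t = (b t * c t - lam * A t) / (b t)\<^sup>2"
    using b_pos[OF t] by (simp add: r_def I_def field_simps power2_eq_square)
  then show ?thesis using energy_nonneg[of t] t by simp
qed

lemma I_mono: "0 < s \<Longrightarrow> s \<le> t \<Longrightarrow> t < S \<Longrightarrow> I s \<le> I t"
  by (rule DERIV_nonneg_imp_nondecreasing[of s t I]) 
     (auto intro!: exI[of _ "1 - 2 * r _ * I _"] dI dI_nonneg)

text \<open>Near \<open>0\<close>, \<open>c\<close> tends to \<open>1\<close> and \<open>b\<close>
  to \<open>0\<close> from above, so \<open>r\<close> blows up, while \<open>I\<close> stays bounded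
  by monotonicity. This makes \<phi> dominate at small times, where the maximum principle has to
  start.\<close>

lemma r_lim: 
  assumes S: "S > 0"
  shows "filterlim (\<lambda>t. r t - lam * I t) at_top (at_right 0)"
proof -
  have "filterlim r at_top (at_right 0)"
  proof -
    have "(c \<longlongrightarrow> 1) (at_right 0)"
      using DERIV_isCont[OF dc[of 0]] by (simp add: isCont_def c0 filterlim_at_split)
    moreover have "(b \<longlongrightarrow> 0) (at_right 0)"
      using DERIV_isCont[OF db[of 0]] by (simp add: isCont_def b0 filterlim_at_split)
    moreover have "\<forall>\<^sub>F t in at_right 0. b t > 0"
      using S b_pos by (auto simp: eventually_at_right)
    ultimately have "filterlim (\<lambda>t. c t / b t) at_top (at_right 0)"
      by (intro LIM_at_top_divide[where a=1]) auto
    then show ?thesis by (simp add: r_def[abs_def])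
  qed
  have "filterlim (\<lambda>t. - \<bar>lam\<bar> * I (S / 2) + r t) at_top (at_right 0)"
    by (rule filterlim_tendsto_add_at_top[OF tendsto_const]) fact
  moreover have "\<forall>\<^sub>F t in at_right 0. - \<bar>lam\<bar> * I (S / 2) + r t \<le> r t - lam * I t"
  proof -
    have "lam * I t \<le> \<bar>lam\<bar> * I (S / 2)" if "0 < t" "t < S / 2" for t
    proof -
      have "lam * I t \<le> \<bar>lam\<bar> * I t" using I_nonneg[of t] that by (intro mult_right_mono) auto
      also have "\<dots> \<le> \<bar>lam\<bar> * I (S / 2)" using I_mono[of t "S / 2"] that by (intro mult_left_mono) auto
      finally show ?thesis .
    qed
    then show ?thesis using S by (auto simp: eventually_at_right intro!: exI[of _ "S / 2"])
  qed
  ultimately show ?thesis by (rule filterlim_at_top_mono)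
qed

lemma isCont_r: "0 < t \<Longrightarrow> t < S \<Longrightarrow> isCont r t"
  using dr DERIV_isCont by blast

end

section \<open>The maximum principle\<close>

text \<open>Read \<open>p\<close> as \<open>2 \<Gamma>(sqrt v) / v\<close> and \<open>q\<close> as
  \<open>Lap v / v\<close>; the bracketed terms are \<alpha>' and \<phi>'. Once \<open>q\<close> is
  expressed by \<open>H\<close>, the terms free of \<open>H\<close> form the square of
  \<open>X / \<alpha> - n * \<kappa>\<close>. The last summand, due to the division of
  \<open>H\<close> by \<open>\<alpha>\<^sup>2\<close>, outweighs the contribution
  \<open>- H * \<alpha>' / \<alpha>\<close> of \<open>q\<close>, and here \<alpha>' \<ge> 0
  matters.\<close>

lemma riccati_square:
  fixes p q r \<alpha> \<phi> n H K :: real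
  assumes n: "n > 0" and \<alpha>: "\<alpha> \<ge> 1" and p: "p \<ge> 0" and \<phi>: "\<phi> \<ge> 0" and H: "H = p - \<alpha> * q - \<phi>" "H > 0"
    and \<alpha>': "0 \<le> 2 * (K + r) - 2 * r * \<alpha>"
  shows "H\<^sup>2 / (n * \<alpha>\<^sup>2) \<le> (p - q)\<^sup>2 / n - 2 * K * p + (2 * (K + r) - 2 * r * \<alpha>) * q
     + (n * (K + r)\<^sup>2 - 2 * r * \<phi>) + 2 * H * (2 * (K + r) - 2 * r * \<alpha>) / \<alpha>"
proof -
  define X where "X = (\<alpha> - 1) * p + \<phi>"
  define \<kappa> where "\<kappa> = K + r"
  have q: "q = (p - \<phi> - H) / \<alpha>" using H \<alpha> by (simp add: field_simps)
  have pq: "p - q = (X + H) / \<alpha>" using \<alpha> unfolding q X_def by (simp add: field_simps)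
  have "(p - q)\<^sup>2 / n - 2 * K * p + (2 * \<kappa> - 2 * r * \<alpha>) * q
     + (n * \<kappa>\<^sup>2 - 2 * r * \<phi>) + 2 * H * (2 * \<kappa> - 2 * r * \<alpha>) / \<alpha> =
     (X / \<alpha> - n * \<kappa>)\<^sup>2 / n + H\<^sup>2 / (n * \<alpha>\<^sup>2) + 2 * H * X / (n * \<alpha>\<^sup>2)
     + H * (2 * \<kappa> - 2 * r * \<alpha>) / \<alpha>"
    unfolding pq q using \<alpha> n
    apply (simp add: divide_simps)
    apply (simp add: X_def \<kappa>_def algebra_simps power2_eq_square)
    done
  moreover have "0 \<le> (X / \<alpha> - n * \<kappa>)\<^sup>2 / n" using n by simp
  moreover have "0 \<le> 2 * H * X / (n * \<alpha>\<^sup>2)" using n H \<alpha> p \<phi> by (simp add: X_def)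
  moreover have "0 \<le> H * (2 * \<kappa> - 2 * r * \<alpha>) / \<alpha>" using H \<alpha> \<alpha>' by (simp add: \<kappa>_def)
  ultimately show ?thesis unfolding \<kappa>_def by linarith
qed

lemma DERIV_sqrt_comp:
  assumes "(g has_real_derivative D) (at t)" "g t > 0"
  shows "((\<lambda>s. sqrt (g s)) has_real_derivative D / (2 * sqrt (g t))) (at t)"
  using DERIV_chain2[OF DERIV_real_sqrt[OF assms(2)] assms(1)]
  by (simp add: field_simps)

context weighted_graph
begin

text \<open>The quantity \<open>H\<close> at a fixed time, with the time derivative already replaced
  by the Laplacian, so that it makes sense for a single function \<open>v\<close>.\<close>

definition li_yau :: "real \<Rightarrow> real \<Rightarrow> ('a \<Rightarrow> real) \<Rightarrow> 'a \<Rightarrow> real" where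
  "li_yau \<alpha> \<phi> v x =
     (2 * Gam (\<lambda>y. sqrt (v y)) (\<lambda>y. sqrt (v y)) x - \<alpha> * Lap v x) / v x - \<phi>"

lemma laplacian_sqrt:
  assumes v: "\<And>y. v y > 0"
  shows "Lap v x = 2 * sqrt (v x) * Lap (\<lambda>y. sqrt (v y)) x
           + 2 * Gam (\<lambda>y. sqrt (v y)) (\<lambda>y. sqrt (v y)) x"
  using laplacian_square[of "\<lambda>y. sqrt (v y)" x] v[THEN less_imp_le] by simp

text \<open>Uses positivity alone: the numerator is
  \<open>(\<alpha> - 1) * (- Lap v x) - 2 * (f x * Lap f x)\<close> with \<open>f = sqrt v\<close>,
  and \<open>laplacian_ge\<close> bounds both Laplacians from below.\<close>

lemma li_yau_le:
  assumes v: "\<And>y. v y > 0" and \<alpha>: "\<alpha> \<ge> 1"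
  shows "li_yau \<alpha> \<phi> v x \<le> (\<alpha> + 1) * ldeg x - \<phi>"
proof -
  define f where "f = (\<lambda>y. sqrt (v y))"
  have 1: "Lap v x \<ge> - (ldeg x * v x)" by (rule laplacian_ge) (simp add: v less_imp_le)
  have "f x * (- (ldeg x * f x)) \<le> f x * Lap f x"
    by (intro mult_left_mono laplacian_ge) (auto simp: f_def v less_imp_le)
  also have "f x * (- (ldeg x * f x)) = - (ldeg x * (f x * f x))" by simp
  also have "f x * f x = v x" using v[of x] by (simp add: f_def)
  finally have 2: "- (ldeg x * v x) \<le> f x * Lap f x" .
  have "2 * Gam f f x - \<alpha> * Lap v x = (\<alpha> - 1) * (- Lap v x) - 2 * (f x * Lap f x)"
    using laplacian_sqrt[of v x, OF v] by (simp add: f_def algebra_simps)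
  also have "\<dots> \<le> (\<alpha> - 1) * (ldeg x * v x) - 2 * (- (ldeg x * v x))"
    using 1 2 \<alpha> by (intro diff_mono mult_left_mono) auto
  finally have "2 * Gam f f x - \<alpha> * Lap v x \<le> (\<alpha> + 1) * ldeg x * v x"
    by (simp add: algebra_simps)
  then show ?thesis using v[of x] by (simp add: li_yau_def f_def divide_le_eq)
qed

text \<open>The part of the bound in \<open>ldeg_le_CDE\<close> that contains \<open>K\<close> is
  absorbed by \<phi>; the rest has the order \<open>\<alpha>\<^sup>2\<close> of the final estimate
  because of \<open>\<alpha> + 1 \<le> 2 * \<alpha>\<^sup>2\<close>.\<close>

lemma li_yau_crude:
  assumes v: "\<And>y. v y > 0" and \<alpha>: "\<alpha> \<ge> 1"
    and cde: "CDE adj w \<mu> n (- K)" "n > 0" "K \<ge> 0"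
    and \<phi>: "\<phi> \<ge> n * K * (\<alpha> + 1) / 2"
  shows "li_yau \<alpha> \<phi> v x \<le> 2 * n * Dmu * \<alpha>\<^sup>2"
proof -
  have "li_yau \<alpha> \<phi> v x \<le> (\<alpha> + 1) * (n * (Dmu + K / 2)) - n * K * (\<alpha> + 1) / 2"
  proof -
    have "(\<alpha> + 1) * ldeg x \<le> (\<alpha> + 1) * (n * (Dmu + K / 2))"
      using ldeg_le_CDE[OF cde, of x] \<alpha> by (intro mult_left_mono) auto
    then show ?thesis using li_yau_le[of v \<alpha> \<phi> x, OF v \<alpha>] \<phi> by linarith
  qed
  also have "\<dots> = (\<alpha> + 1) * (n * Dmu)" by (simp add: field_simps)
  also have "\<dots> \<le> (2 * \<alpha>\<^sup>2) * (n * Dmu)"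
  proof (rule mult_right_mono)
    have "\<alpha> * 1 \<le> \<alpha> * \<alpha>" using \<alpha> by (intro mult_left_mono) auto
    then show "\<alpha> + 1 \<le> 2 * \<alpha>\<^sup>2" using \<alpha> unfolding power2_eq_square by linarith
  qed (use cde D_mu_nonneg in simp)
  finally show ?thesis by (simp add: algebra_simps)
qed

text \<open>A negative Laplacian bounds the weighted sum of the \<open>f y\<close> by
  \<open>wdeg adj w x * f x\<close>. A single term of that sum gives
  \<open>f y \<le> Dom * f x\<close>; of the two factors in \<open>(f y)\<^sup>2\<close> one is
  estimated pointwise, the other by the sum.\<close>

lemma neighbour_sum_squares_le:
  assumes f: "\<And>y. f y > 0" and neg: "Lap f x < 0"
  shows "(1 / \<mu> x) * (\<Sum>y | adj x y. w x y * (f y)\<^sup>2) \<le> Dom * Dmu * (f x)\<^sup>2"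
proof (cases "\<exists>y. adj x y")
  case False
  have "0 \<le> Dom * Dmu" using D_mu_nonneg D_mu_le_D_mu_D_omega by (simp add: mult.commute)
  then show ?thesis using False by simp
next
  case True
  then have Dom: "1 \<le> Dom" using D_omega_ge_1 by blast
  have mx: "\<mu> x > 0" by (rule measure_pos)
  have "(\<Sum>y | adj x y. w x y * (f y - f x)) < 0"
    using neg mx by (simp add: laplacian_def divide_less_0_iff)
  then have sum_le: "(\<Sum>y | adj x y. w x y * f y) \<le> wdeg adj w x * f x"
    by (simp add: wdeg_def right_diff_distrib sum_subtractf sum_distrib_right)
  have fy: "f y \<le> Dom * f x" if "adj x y" for y
  proof -
    have "w x y * f y \<le> (\<Sum>y | adj x y. w x y * f y)"
      using that f
      by (intro member_le_sum) (auto intro: locally_finite less_imp_le weight_pos intro!: mult_nonneg_nonneg)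
    also note sum_le
    also have "wdeg adj w x * f x \<le> Dom * w x y * f x"
      using wdeg_le_D_omega[OF that] f[of x] by simp
    finally have "w x y * f y \<le> w x y * (Dom * f x)" by (simp add: mult_ac)
    then show ?thesis using weight_pos[OF that] by simp
  qed
  have "(\<Sum>y | adj x y. w x y * (f y)\<^sup>2) \<le> (\<Sum>y | adj x y. Dom * f x * (w x y * f y))"
  proof (rule sum_mono)
    fix y assume "y \<in> {y. adj x y}"
    then have "(w x y * f y) * f y \<le> (w x y * f y) * (Dom * f x)"
      using f[of y] fy[of y] weight_pos[of x y] by (intro mult_left_mono) auto
    then show "w x y * (f y)\<^sup>2 \<le> Dom * f x * (w x y * f y)"
      by (simp add: power2_eq_square mult_ac)
  qed
  also have "\<dots> \<le> Dom * f x * (wdeg adj w x * f x)"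
    unfolding sum_distrib_left[symmetric] using sum_le Dom f[of x] by (intro mult_left_mono) auto
  finally have "(1 / \<mu> x) * (\<Sum>y | adj x y. w x y * (f y)\<^sup>2)
      \<le> (1 / \<mu> x) * (Dom * f x * (wdeg adj w x * f x))"
    using mx by (intro mult_left_mono) auto
  also have "\<dots> = (Dom * (f x)\<^sup>2) * (wdeg adj w x / \<mu> x)"
    by (simp add: power2_eq_square)
  also have "\<dots> \<le> (Dom * (f x)\<^sup>2) * Dmu"
    using Dom wdeg_le_D_mu by (intro mult_left_mono) auto
  finally show ?thesis by (simp add: mult_ac)
qed

section \<open>Time derivatives and the maximum principle\<close>

lemma DERIV_laplacian:
  assumes "\<And>y. y = x \<or> adj x y \<Longrightarrow> ((\<lambda>s. g s y) has_real_derivative g' y) (at t)"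
  shows "((\<lambda>s. Lap (g s) x) has_real_derivative Lap g' x) (at t)"
  unfolding laplacian_def by (intro DERIV_cmult DERIV_sum DERIV_diff assms) auto

lemma DERIV_gradient_form:
  assumes "\<And>y. y = x \<or> adj x y \<Longrightarrow> ((\<lambda>s. g s y) has_real_derivative g' y) (at t)"
  shows "((\<lambda>s. Gam (g s) (g s) x) has_real_derivative 2 * Gam (g t) g' x) (at t)"
proof -
  have "((\<lambda>s. Gam (g s) (g s) x) has_real_derivative
     (1 / (2 * \<mu> x)) * (\<Sum>y | adj x y. 2 * (w x y * (g t y - g t x) * (g' y - g' x)))) (at t)"
    unfolding gradient_form_def
  proof (intro DERIV_cmult DERIV_sum)
    fix y assume "y \<in> {y. adj x y}"
    then have d: "((\<lambda>s. g s y - g s x) has_real_derivative g' y - g' x) (at t)"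
      by (intro DERIV_diff assms) auto
    show "((\<lambda>s. w x y * (g s y - g s x) * (g s y - g s x)) has_real_derivative
        2 * (w x y * (g t y - g t x) * (g' y - g' x))) (at t)"
      by (rule derivative_eq_intros d refl)+ (simp add: algebra_simps)
  qed
  then show ?thesis
    unfolding gradient_form_def sum_distrib_left[symmetric] by (simp add: mult_ac)
qed

text \<open>\<open>space\<close> and \<open>time\<close> are what a maximum of the cut-off quantity
  provides: a relative excess of at most \<open>e\<close> at neighbours, and no decrease in time.
  The curvature condition for \<open>sqrt u\<close> and \<open>riccati_square\<close> then bound
  \<open>H\<^sup>2 / (n * \<alpha>\<^sup>2)\<close> by a multiple of \<open>H\<close>, and one
  factor \<open>H\<close> cancels.\<close>

lemma li_yau_max_point:
  fixes u :: "real \<Rightarrow> 'a \<Rightarrow> real" and \<alpha> \<phi> :: "real \<Rightarrow> real"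
  defines "L \<equiv> \<lambda>s. li_yau (\<alpha> s) (\<phi> s) (u s)"
  assumes cde: "CDE adj w \<mu> n (- K)" and n: "n > 0"
    and u_pos: "\<And>y s. u s y > 0"
    and du: "\<And>y. y = x \<or> adj x y \<Longrightarrow> ((\<lambda>s. u s y) has_real_derivative Lap (u t) y) (at t)"
    and d\<alpha>: "(\<alpha> has_real_derivative 2 * (K + r) - 2 * r * \<alpha> t) (at t)"
    and d\<phi>: "(\<phi> has_real_derivative n * (K + r)\<^sup>2 - 2 * r * \<phi> t) (at t)"
    and \<alpha>: "\<alpha> t \<ge> 1" and \<phi>: "\<phi> t \<ge> 0" and \<alpha>': "0 \<le> 2 * (K + r) - 2 * r * \<alpha> t"
    and pos: "L t x > 0" and e: "e \<ge> 0"
    and space: "\<And>y. adj x y \<Longrightarrow> L t y - L t x \<le> L t x * e"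
    and time: "\<And>D. ((\<lambda>s. L s x / (\<alpha> s)\<^sup>2) has_real_derivative D) (at t) \<Longrightarrow> 0 \<le> D"
  shows "L t x \<le> n * (\<alpha> t)\<^sup>2 * (e * (Dom * Dmu))"
proof -
  define a' where "a' = 2 * (K + r) - 2 * r * \<alpha> t"
  define p' where "p' = n * (K + r)\<^sup>2 - 2 * r * \<phi> t"
  define v where "v = u t"
  define f where "f = (\<lambda>y. sqrt (v y))"
  \<comment> \<open>At \<open>x\<close> and its neighbours \<open>h\<close> is the time derivative
    of \<open>sqrt u\<close>; it is also the second argument of the gradient form in
    \<open>Gamma2_tilde\<close> for \<open>f\<close>.\<close>
  define h where "h = (\<lambda>y. Lap v y / (2 * f y))"
  define H where "H = L t x"
  define N where "N = (\<lambda>y. 2 * Gam f f y - \<alpha> t * Lap v y)"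
  define N' where "N' = 4 * Gam f h x - a' * Lap v x - \<alpha> t * Lap (Lap v) x"
  have v: "v y > 0" for y by (simp add: v_def u_pos)
  have f: "f y > 0" for y by (simp add: f_def v)
  have f2: "(f y)\<^sup>2 = v y" for y using v[of y] by (simp add: f_def)
  have Lt: "L t y = N y / v y - \<phi> t" for y
    unfolding L_def li_yau_def N_def f_def v_def ..
  have N: "N y = v y * (L t y + \<phi> t)" for y using v[of y] unfolding Lt by simp

  have dN: "((\<lambda>s. 2 * Gam (\<lambda>y. sqrt (u s y)) (\<lambda>y. sqrt (u s y)) x - \<alpha> s * Lap (u s) x)
      has_real_derivative N') (at t)"
  proof -
    have 1: "((\<lambda>s. Gam (\<lambda>y. sqrt (u s y)) (\<lambda>y. sqrt (u s y)) x) has_real_derivative 2 * Gam f h x) (at t)"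
    proof -
      have "((\<lambda>s. sqrt (u s y)) has_real_derivative h y) (at t)" if "y = x \<or> adj x y" for y
        unfolding h_def f_def v_def by (rule DERIV_sqrt_comp) (rule du[OF that] u_pos)+
      from DERIV_gradient_form[where g="\<lambda>s y. sqrt (u s y)" and g'=h and x=x and t=t, OF this]
      show ?thesis by (simp add: f_def v_def)
    qed
    have 2: "((\<lambda>s. Lap (u s) x) has_real_derivative Lap (Lap v) x) (at t)"
      unfolding v_def by (rule DERIV_laplacian) (rule du)
    show ?thesis
      using DERIV_diff[OF DERIV_cmult[OF 1, of 2] DERIV_mult[OF d\<alpha> 2]]
      by (simp add: N'_def a'_def v_def algebra_simps)
  qed
  have "((\<lambda>s. L s x / (\<alpha> s)\<^sup>2) has_real_derivative
      (((N' * v x - N x * Lap v x) / (v x * v x) - p') * (\<alpha> t)\<^sup>2 - H * (2 * \<alpha> t * a'))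
        / ((\<alpha> t)\<^sup>2 * (\<alpha> t)\<^sup>2)) (at t)"
  proof -
    have "((\<lambda>s. (2 * Gam (\<lambda>y. sqrt (u s y)) (\<lambda>y. sqrt (u s y)) x - \<alpha> s * Lap (u s) x) / u s x)
      has_real_derivative (N' * v x - N x * Lap v x) / (v x * v x)) (at t)"
      using DERIV_divide[OF dN, of "\<lambda>s. u s x" "Lap v x"] du[of x] v[of x] by (simp add: v_def N_def f_def)
    from DERIV_diff[OF this d\<phi>]
    have dL: "((\<lambda>s. L s x) has_real_derivative (N' * v x - N x * Lap v x) / (v x * v x) - p') (at t)"
      by (simp add: L_def li_yau_def p'_def)
    have dsq: "((\<lambda>s. (\<alpha> s)\<^sup>2) has_real_derivative 2 * \<alpha> t * a') (at t)"
      using DERIV_power[OF d\<alpha>, of 2] by (simp add: a'_def mult_ac)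
    show ?thesis
      using DERIV_divide[OF dL dsq] \<alpha> by (simp add: H_def)
  qed
  from time[OF this] have "0 \<le> ((N' * v x - N x * Lap v x) / (v x * v x) - p') * (\<alpha> t)\<^sup>2 - H * (2 * \<alpha> t * a')"
    using \<alpha> by (simp add: zero_le_divide_iff)
  also have "\<dots> = \<alpha> t * v x * ((N' - (H + \<phi> t) * Lap v x - p' * v x) * \<alpha> t - 2 * H * a' * v x) / (v x * v x)"
    using v[of x] \<alpha> unfolding N[of x] H_def[symmetric]
    by (simp add: divide_simps) (simp add: algebra_simps power2_eq_square)
  also have "\<dots> = (\<alpha> t)\<^sup>2 / v x * (N' - (H + \<phi> t) * Lap v x - p' * v x - 2 * H * a' / \<alpha> t * v x)"
    using v[of x] \<alpha> by (simp add: field_simps power2_eq_square)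
  finally have N'_ge: "0 \<le> N' - (H + \<phi> t) * Lap v x - p' * v x - 2 * H * a' / \<alpha> t * v x"
    using v[of x] \<alpha> by (simp add: zero_le_mult_iff zero_le_divide_iff) 

  define p q where "p = 2 * Gam f f x / v x" and "q = Lap v x / v x"
  have p0: "p \<ge> 0" using v[of x] by (simp add: p_def gradient_form_nonneg)
  have Hpq: "H = p - \<alpha> t * q - \<phi> t"
    by (simp add: H_def Lt N_def p_def q_def diff_divide_distrib)
  have pq: "p - q = - 2 * f x * Lap f x / v x"
    using laplacian_sqrt[of v x, OF v] by (simp add: p_def q_def f_def diff_divide_distrib[symmetric])
  \<comment> \<open>\<open>CDE\<close> says something only where the Laplacian of \<open>f\<close>
    is negative; the positivity of \<open>H\<close> ensures this.\<close>
  have "\<alpha> t * (p - q) = H + \<phi> t + (\<alpha> t - 1) * p" by (simp add: Hpq algebra_simps)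
  also have "\<dots> > 0" using pos \<phi> p0 \<alpha> by (simp add: H_def add_pos_nonneg)
  finally have "p - q > 0" using \<alpha> by (simp add: zero_less_mult_iff)
  then have neg: "Lap f x < 0"
    unfolding pq using v[of x] f[of x] by (simp add: divide_less_0_iff mult_less_0_iff)

  \<comment> \<open>Since \<open>N y = v y * (L t y + \<phi> t)\<close>, subtracting
    \<open>(H + \<phi> t) * Lap v x\<close> leaves only the differences \<open>L t y - H\<close>,
    which \<open>space\<close> controls.\<close>
  have "Lap N x - (H + \<phi> t) * Lap v x = (1 / \<mu> x) * (\<Sum>y | adj x y. w x y * v y * (L t y - H))"
  proof -
    have "(\<Sum>y | adj x y. w x y * (N y - N x)) - (H + \<phi> t) * (\<Sum>y | adj x y. w x y * (v y - v x))
        = (\<Sum>y | adj x y. w x y * v y * (L t y - H))"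
      unfolding sum_distrib_left sum_subtractf[symmetric]
      by (intro sum.cong refl) (simp add: N H_def algebra_simps)
    moreover have "1 / \<mu> x * S - (H + \<phi> t) * (1 / \<mu> x * S') = 1 / \<mu> x * (S - (H + \<phi> t) * S')" for S S'
      by (simp only: right_diff_distrib mult_ac)
    ultimately show ?thesis
      unfolding laplacian_def by (simp only:)
  qed
  also have "\<dots> \<le> (1 / \<mu> x) * (\<Sum>y | adj x y. w x y * (f y)\<^sup>2 * (H * e))"
    using measure_pos[of x] space v weight_pos
    by (intro mult_left_mono sum_mono) (auto simp: f2 H_def intro!: mult_left_mono less_imp_le)
  also have "\<dots> = (1 / \<mu> x) * (\<Sum>y | adj x y. w x y * (f y)\<^sup>2) * (H * e)"
    by (simp add: sum_distrib_right)
  also have "\<dots> \<le> Dom * Dmu * (f x)\<^sup>2 * (H * e)"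
    using neighbour_sum_squares_le[of f x] f neg pos e by (intro mult_right_mono) (auto simp: H_def)
  finally have LapN: "Lap N x - (H + \<phi> t) * Lap v x \<le> H * (e * (Dom * Dmu)) * v x"
    by (simp add: f2 mult_ac)

  \<comment> \<open>The term \<open>\<alpha> t * Lap (Lap v) x\<close> also occurs in
    \<open>N'\<close> and cancels in \<open>Lap N x - N'\<close>; what remains is four times
    \<open>Gamma2_tilde\<close> plus \<open>a' * Lap v x\<close>.\<close>
  have LapN_eq: "Lap N x = 2 * Lap (Gam f f) x - \<alpha> t * Lap (Lap v) x"
  proof -
    have "(\<Sum>y | adj x y. w x y * (N y - N x)) = 2 * (\<Sum>y | adj x y. w x y * (Gam f f y - Gam f f x))
        - \<alpha> t * (\<Sum>y | adj x y. w x y * (Lap v y - Lap v x))"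
      unfolding sum_distrib_left sum_subtractf[symmetric] N_def
      by (intro sum.cong refl) (simp add: algebra_simps)
    moreover have "1 / \<mu> x * (2 * S - \<alpha> t * S') = 2 * (1 / \<mu> x * S) - \<alpha> t * (1 / \<mu> x * S')" for S S'
      by (simp only: right_diff_distrib mult_ac)
    ultimately show ?thesis
      unfolding laplacian_def[of adj w \<mu> N] laplacian_def[of adj w \<mu> "Gam f f"]
        laplacian_def[of adj w \<mu> "Lap v"] by (simp only:)
  qed
  have "Gamma2_tilde adj w \<mu> f x \<ge> 1 / n * (Lap f x)\<^sup>2 + (- K) * Gam f f x"
    using cde[unfolded CDE_def] f neg by blast
  moreover have "Gamma2_tilde adj w \<mu> f x = 1 / 2 * Lap (Gam f f) x - Gam f h x"
    by (simp add: Gamma2_tilde_def h_def f2)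
  ultimately have "4 / n * (Lap f x)\<^sup>2 - 4 * K * Gam f f x \<le> 2 * Lap (Gam f f) x - 4 * Gam f h x"
    by (simp add: field_simps)
  also have "\<dots> = Lap N x - N' - a' * Lap v x"
    by (simp add: LapN_eq N'_def)
  also have "\<dots> \<le> H * (e * (Dom * Dmu)) * v x - p' * v x - 2 * H * a' / \<alpha> t * v x - a' * Lap v x"
    using LapN N'_ge by linarith
  finally have "(4 / n * (Lap f x)\<^sup>2 - 4 * K * Gam f f x) / v x \<le>
     (H * (e * (Dom * Dmu)) * v x - p' * v x - 2 * H * a' / \<alpha> t * v x - a' * Lap v x) / v x"
    using v[of x] by (intro divide_right_mono) auto
  also have "\<dots> = H * (e * (Dom * Dmu)) - p' - 2 * H * a' / \<alpha> t - a' * q"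
    using v[of x] by (simp add: q_def diff_divide_distrib)
  also have "(4 / n * (Lap f x)\<^sup>2 - 4 * K * Gam f f x) / v x = (p - q)\<^sup>2 / n - 2 * K * p"
  proof -
    have "(p - q)\<^sup>2 = 4 * (Lap f x)\<^sup>2 / v x"
      using v[of x] unfolding pq power_divide power_mult_distrib f2
      by (simp add: power2_eq_square)
    then show ?thesis by (simp add: p_def diff_divide_distrib mult_ac)
  qed
  finally have "(p - q)\<^sup>2 / n - 2 * K * p + a' * q + p' + 2 * H * a' / \<alpha> t \<le> H * (e * (Dom * Dmu))"
    by simp
  with riccati_square[OF n \<alpha> p0 \<phi> Hpq _ \<alpha>'] pos
  have "H\<^sup>2 / (n * (\<alpha> t)\<^sup>2) \<le> H * (e * (Dom * Dmu))"
    unfolding H_def a'_def p'_def by linarith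
  then have "H * H \<le> H * (n * (\<alpha> t)\<^sup>2 * (e * (Dom * Dmu)))"
    using n \<alpha> by (simp add: divide_le_eq power2_eq_square mult_ac)
  then show ?thesis using pos by (simp add: H_def)
qed

text \<open>If the bound fails, \<open>F\<close>, which is \<psi> times
  \<open>H / \<alpha>\<^sup>2\<close>, exceeds \<open>C\<close> somewhere. Small times are excluded
  by the growth of \<phi>, small \<psi> by the crude bound, so a maximum is attained on a finite set
  times a compact interval, where \<open>li_yau_max_point\<close> contradicts it.\<close>

lemma li_yau_cutoff:
  fixes u :: "real \<Rightarrow> 'a \<Rightarrow> real" and \<alpha> \<phi> r :: "real \<Rightarrow> real" and \<psi> :: "'a \<Rightarrow> real"
  assumes cde: "CDE adj w \<mu> n (- K)" and n: "n > 0" and K: "K \<ge> 0" and R: "R > 0"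
    and u_pos: "\<And>y s. u s y > 0"
    and du: "\<And>y t. \<psi> y \<ge> 0 \<Longrightarrow> ((\<lambda>s. u s y) has_real_derivative Lap (u t) y) (at t)"
    and lip: "\<And>y z. adj y z \<Longrightarrow> \<psi> y \<le> \<psi> z + 1 / R"
    and fin: "finite {y. \<psi> y \<ge> 0}"
    and T: "T > 0"
    and d\<alpha>: "\<And>t. 0 < t \<Longrightarrow> t \<le> T \<Longrightarrow>
      (\<alpha> has_real_derivative 2 * (K + r t) - 2 * r t * \<alpha> t) (at t)"
    and d\<phi>: "\<And>t. 0 < t \<Longrightarrow> t \<le> T \<Longrightarrow>
      (\<phi> has_real_derivative n * (K + r t)\<^sup>2 - 2 * r t * \<phi> t) (at t)"
    and \<alpha>: "\<And>t. 0 < t \<Longrightarrow> t \<le> T \<Longrightarrow> \<alpha> t \<ge> 1"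
    and \<alpha>': "\<And>t. 0 < t \<Longrightarrow> t \<le> T \<Longrightarrow> 0 \<le> 2 * (K + r t) - 2 * r t * \<alpha> t"
    and \<phi>: "\<And>t. 0 < t \<Longrightarrow> t \<le> T \<Longrightarrow> \<phi> t \<ge> n * K * (\<alpha> t + 1) / 2"
    and \<phi>_lim: "filterlim \<phi> at_top (at_right 0)"
    and x: "\<psi> x \<ge> 0"
  shows "\<psi> x * li_yau (\<alpha> T) (\<phi> T) (u T) x \<le> 2 * n * Dmu * (1 + Dom) * (\<alpha> T)\<^sup>2 / R"
proof (rule ccontr)
  define C where "C = 2 * n * Dmu * (1 + Dom) / R"
  define L where "L = (\<lambda>y t. li_yau (\<alpha> t) (\<phi> t) (u t) y)"
  define F where "F = (\<lambda>y t. \<psi> y * (L y t / (\<alpha> t)\<^sup>2))"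
  \<comment> \<open>every neighbour of a point of \<open>B\<close> still has \<open>\<psi> > 0\<close>; outside \<open>B\<close> the crude bound suffices\<close>
  define B where "B = {y. \<psi> y \<ge> 2 / R}"
  assume "\<not> ?thesis"
  then have "C * (\<alpha> T)\<^sup>2 < \<psi> x * L x T" by (simp add: C_def L_def)
  then have xC: "C < F x T"
    using \<alpha>[of T] T by (simp add: F_def pos_less_divide_eq)
  have Dom0: "Dmu \<le> Dmu * Dom" by (rule D_mu_le_D_mu_D_omega)
  \<comment> \<open>The first bound serves the region outside \<open>B\<close>, the second the
    maximum point. \<open>Dmu \<le> Dmu * Dom\<close> lets one constant cover both.\<close>
  have C_ge: "4 * n * Dmu / R \<le> C" "2 * n * (Dom * Dmu) / R \<le> C"
  proof -
    have "2 * n * Dmu \<le> 2 * n * (Dmu * Dom)" using Dom0 n by (intro mult_left_mono) auto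
    moreover have "0 \<le> 2 * n * Dmu" using n D_mu_nonneg by simp
    moreover have "2 * n * Dmu * (1 + Dom) = 2 * n * Dmu + 2 * n * (Dmu * Dom)"
      by (simp add: algebra_simps)
    moreover have "2 * n * (Dom * Dmu) = 2 * n * (Dmu * Dom)" by simp
    ultimately show "4 * n * Dmu / R \<le> C" "2 * n * (Dom * Dmu) / R \<le> C"
      unfolding C_def using R by (intro divide_right_mono; linarith)+
  qed
  have "0 \<le> 4 * n * Dmu / R" using n R D_mu_nonneg by simp
  then have C0: "0 \<le> C" using C_ge by linarith

  have crude: "F y t \<le> C" if t: "0 < t" "t \<le> T" and y: "0 \<le> \<psi> y" "\<psi> y < 2 / R" for y t
  proof -
    have "L y t \<le> 2 * n * Dmu * (\<alpha> t)\<^sup>2"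
      unfolding L_def using \<alpha>[OF t] \<phi>[OF t] by (intro li_yau_crude[OF _ _ cde n K] u_pos) auto
    then have "L y t / (\<alpha> t)\<^sup>2 \<le> 2 * n * Dmu"
      using \<alpha>[OF t] by (simp add: divide_le_eq)
    then have "F y t \<le> \<psi> y * (2 * n * Dmu)"
      unfolding F_def using y by (intro mult_left_mono) auto
    also have "\<dots> \<le> 2 / R * (2 * n * Dmu)"
      using y n D_mu_nonneg by (intro mult_right_mono) auto
    finally show ?thesis using C_ge by simp
  qed
  have \<alpha>_le: "\<alpha> t \<le> \<alpha> T" if "0 < t" "t \<le> T" for t
    using that(2)
  proof (rule DERIV_nonneg_imp_nondecreasing)
    fix s assume "t \<le> s" "s \<le> T"
    then show "\<exists>y. DERIV \<alpha> s :> y \<and> 0 \<le> y" using d\<alpha>[of s] \<alpha>'[of s] that by auto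
  qed
  \<comment> \<open>\<open>\<alpha>_le\<close> makes the bound of \<open>li_yau_le\<close> uniform
    in time, so \<phi> exceeds it before some \<open>\<epsilon>\<^sub>0\<close>.\<close>
  obtain \<epsilon>\<^sub>0 where \<epsilon>\<^sub>0: "\<epsilon>\<^sub>0 > 0" "\<And>t. 0 < t \<Longrightarrow> t < \<epsilon>\<^sub>0 \<Longrightarrow> (\<alpha> T + 1) * Dmu \<le> \<phi> t"
  proof -
    have "\<forall>\<^sub>F t in at_right 0. (\<alpha> T + 1) * Dmu \<le> \<phi> t"
      using \<phi>_lim by (simp add: filterlim_at_top)
    then obtain b where "b > 0" "\<forall>t>0. t < b \<longrightarrow> (\<alpha> T + 1) * Dmu \<le> \<phi> t"
      by (auto simp: eventually_at_right_field)
    then show ?thesis using that[of b] by blast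
  qed
  define \<epsilon> where "\<epsilon> = min T (\<epsilon>\<^sub>0 / 2)"
  have \<epsilon>: "0 < \<epsilon>" "\<epsilon> \<le> T" "\<epsilon> < \<epsilon>\<^sub>0" using T \<epsilon>\<^sub>0 by (auto simp: \<epsilon>_def)
  have early: "F y t \<le> 0" if t: "0 < t" "t \<le> T" "t < \<epsilon>" and y: "0 \<le> \<psi> y" for y t
  proof -
    have "L y t \<le> (\<alpha> t + 1) * ldeg y - \<phi> t"
      unfolding L_def by (rule li_yau_le) (use \<alpha>[OF t(1,2)] u_pos in auto)
    also have "(\<alpha> t + 1) * ldeg y \<le> (\<alpha> T + 1) * Dmu"
      using \<alpha>_le[OF t(1,2)] \<alpha>[OF t(1,2)] ldeg_le_D_mu[of y] ldeg_nonneg[of y]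
      by (intro mult_mono) auto
    also have "\<dots> \<le> \<phi> t" using \<epsilon>\<^sub>0(2)[of t] t \<epsilon> by auto
    finally have "L y t \<le> 0" by simp
    then show ?thesis unfolding F_def using y by (simp add: mult_nonneg_nonpos divide_nonpos_nonneg)
  qed

  have xB: "x \<in> B" using crude[of T x] xC T x by (cases "\<psi> x < 2 / R") (auto simp: B_def)
  have B0: "0 < \<psi> y" if "y \<in> B" for y
    using that R by (auto simp: B_def intro: less_le_trans[of _ "2 / R"])
  \<comment> \<open>The Lipschitz loss \<open>1 / R\<close> is at most half of
    \<open>\<psi> y\<close>, because \<open>\<psi> y \<ge> 2 / R\<close> on
    \<open>B\<close>.\<close>
  have nb: "\<psi> y - 1 / R \<le> \<psi> z" "\<psi> y / 2 \<le> \<psi> z" if "y \<in> B" "adj y z" for y z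
  proof -
    have "2 * (1 / R) \<le> \<psi> y" using that(1) by (simp add: B_def)
    then show "\<psi> y - 1 / R \<le> \<psi> z" "\<psi> y / 2 \<le> \<psi> z"
      using lip[OF that(2)] by linarith+
  qed
  have du': "((\<lambda>s. u s z) has_real_derivative Lap (u t) z) (at t)"
    if "y \<in> B" "z = y \<or> adj y z" for y z t
  proof (rule du)
    show "0 \<le> \<psi> z"
      using that(2) B0[OF that(1)] nb(2)[OF that(1), of z] by auto
  qed
  have dF: "\<exists>D. ((\<lambda>t. L y t / (\<alpha> t)\<^sup>2) has_real_derivative D) (at t)"
    if y: "y \<in> B" and t: "0 < t" "t \<le> T" for y t
  proof -
    have ds: "((\<lambda>s. sqrt (u s z)) has_real_derivative Lap (u t) z / (2 * sqrt (u t z))) (at t)"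
      if "z = y \<or> adj y z" for z
      by (rule DERIV_sqrt_comp) (rule du'[OF y that] u_pos)+
    have 1: "((\<lambda>s. Lap (u s) y) has_real_derivative Lap (Lap (u t)) y) (at t)"
      by (rule DERIV_laplacian) (rule du'[OF y])
    have 2: "((\<lambda>s. Gam (\<lambda>z. sqrt (u s z)) (\<lambda>z. sqrt (u s z)) y) has_real_derivative
        2 * Gam (\<lambda>z. sqrt (u t z)) (\<lambda>z. Lap (u t) z / (2 * sqrt (u t z))) y) (at t)"
      by (rule DERIV_gradient_form) (rule ds)
    have 3: "((\<lambda>s. u s y) has_real_derivative Lap (u t) y) (at t)" by (rule du'[OF y]) simp
    have 4: "u t y \<noteq> 0" using u_pos[of t y] by simp
    have 5: "(\<alpha> t)\<^sup>2 \<noteq> 0" using \<alpha>[OF t] by simp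
    note 6 = DERIV_diff[OF DERIV_cmult[OF 2, of 2] DERIV_mult[OF d\<alpha>[OF t] 1]]
    note 7 = DERIV_diff[OF DERIV_divide[OF 6 3 4] d\<phi>[OF t]]
    note 8 = DERIV_power[OF d\<alpha>[OF t], of 2]
    show ?thesis
      unfolding L_def li_yau_def by (rule exI) (rule DERIV_divide[OF 7 8 5])
  qed
  have "\<exists>t\<in>{\<epsilon>..T}. \<forall>s\<in>{\<epsilon>..T}. F y s \<le> F y t" if y: "y \<in> B" for y
  proof (rule continuous_attains_sup)
    have "isCont (\<lambda>t. L y t / (\<alpha> t)\<^sup>2) t" if "t \<in> {\<epsilon>..T}" for t
      using dF[OF y, of t] that \<epsilon> DERIV_isCont by fastforce
    then show "continuous_on {\<epsilon>..T} (F y)"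
      unfolding F_def by (intro continuous_on_mult_left continuous_at_imp_continuous_on) auto
  qed (use \<epsilon> in auto)
  then obtain \<tau> where \<tau>: "\<And>y. y \<in> B \<Longrightarrow> \<tau> y \<in> {\<epsilon>..T}"
    "\<And>y s. y \<in> B \<Longrightarrow> s \<in> {\<epsilon>..T} \<Longrightarrow> F y s \<le> F y (\<tau> y)"
    by metis
  have finB: "finite B"
    using B0 by (intro finite_subset[OF _ fin]) (auto intro: less_imp_le)
  define M where "M = Max ((\<lambda>y. F y (\<tau> y)) ` B)"
  have "M \<in> (\<lambda>y. F y (\<tau> y)) ` B"
    unfolding M_def using finB xB by (intro Max_in) auto
  then obtain y where y: "y \<in> B" "F y (\<tau> y) = M" by auto
  define t where "t = \<tau> y"
  have t: "0 < t" "t \<le> T" "\<epsilon> \<le> t" using \<tau>(1)[OF y(1)] \<epsilon> by (auto simp: t_def)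
  have FM: "F z s \<le> M" if "z \<in> B" "s \<in> {\<epsilon>..T}" for z s
    using \<tau>(2)[OF that] that(1) finB unfolding M_def by (meson Max_ge finite_imageI imageI order_trans)
  have MC: "C < M" using FM[OF xB, of T] xC \<epsilon> by auto
  \<comment> \<open>Outside \<open>B\<close> the crude bound stays below \<open>C < M\<close>, so at
    time \<open>t\<close> the maximum over \<open>B\<close> is one over all \<open>z\<close> with
    \<open>\<psi> z \<ge> 0\<close>.\<close>
  have FM': "F z t \<le> M" if "0 \<le> \<psi> z" for z
    using FM[of z t] crude[OF t(1,2) that] MC t by (cases "z \<in> B") (auto simp: B_def)
  have Ft: "F y t = M" using y by (simp add: t_def)
  define H where "H = L y t"
  have \<psi>y: "0 < \<psi> y" using B0[OF y(1)] .
  have "0 < F y t" using Ft MC C0 by simp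
  then have H: "0 < H"
    using \<psi>y \<alpha>[OF t(1,2)] by (simp add: F_def H_def zero_less_mult_iff zero_less_divide_iff)
  have \<alpha>2: "0 < (\<alpha> t)\<^sup>2" using \<alpha>[OF t(1,2)] by simp
  \<comment> \<open>The slack \<open>2 / (R * \<psi> y)\<close> uses both parts of
    \<open>nb\<close>: maximality gives \<open>\<psi> z * (L z t - H) \<le> H / R\<close>, and
    \<open>\<psi> z\<close> is at least half of \<open>\<psi> y\<close>.\<close>
  have "H \<le> n * (\<alpha> t)\<^sup>2 * (2 / (R * \<psi> y) * (Dom * Dmu))"
    unfolding H_def L_def
  proof (rule li_yau_max_point[OF cde n u_pos _ d\<alpha>[OF t(1,2)] d\<phi>[OF t(1,2)] \<alpha>[OF t(1,2)] _ \<alpha>'[OF t(1,2)]])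
    show "((\<lambda>s. u s z) has_real_derivative Lap (u t) z) (at t)" if "z = y \<or> adj y z" for z
      by (rule du'[OF y(1) that])
    have "0 \<le> n * K * (\<alpha> t + 1) / 2" using n K \<alpha>[OF t(1,2)] by simp
    then show "0 \<le> \<phi> t" using \<phi>[OF t(1,2)] by linarith
    show "0 < li_yau (\<alpha> t) (\<phi> t) (u t) y" using H by (simp add: H_def L_def)
    show "0 \<le> 2 / (R * \<psi> y)" using R \<psi>y by simp
  next
    fix z assume z: "adj y z"
    note nb = nb[OF y(1) z]
    have \<psi>z: "0 < \<psi> z" using nb \<psi>y by linarith
    have "\<psi> z * L z t \<le> \<psi> y * H"
    proof -
      have "(\<psi> z * L z t) / (\<alpha> t)\<^sup>2 \<le> (\<psi> y * H) / (\<alpha> t)\<^sup>2"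
        using FM'[of z] \<psi>z unfolding Ft[symmetric] F_def H_def by simp
      then show ?thesis using \<alpha>2 by (simp only: divide_le_cancel)
    qed
    then have "\<psi> z * (L z t - H) \<le> (\<psi> y - \<psi> z) * H" by (simp add: algebra_simps)
    also have "\<dots> \<le> (1 / R) * H" using nb H by (intro mult_right_mono) auto
    also have "\<dots> = (\<psi> y / 2) * (H * (2 / (R * \<psi> y)))" using \<psi>y by simp
    also have "\<dots> \<le> \<psi> z * (H * (2 / (R * \<psi> y)))" using nb H R \<psi>y by (intro mult_right_mono) auto
    finally show "li_yau (\<alpha> t) (\<phi> t) (u t) z - li_yau (\<alpha> t) (\<phi> t) (u t) y
        \<le> li_yau (\<alpha> t) (\<phi> t) (u t) y * (2 / (R * \<psi> y))"
      using \<psi>z by (simp only: mult_le_cancel_left_pos) (simp add: L_def H_def)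
  next
    fix D assume D: "((\<lambda>s. li_yau (\<alpha> s) (\<phi> s) (u s) y / (\<alpha> s)\<^sup>2) has_real_derivative D) (at t)"
    \<comment> \<open>\<open>t\<close> may be the endpoint \<open>T\<close>, so the comparison is
      with earlier times only; those before \<epsilon> are handled by \<open>early\<close>.\<close>
    show "0 \<le> D"
    proof (rule ccontr)
      assume "\<not> 0 \<le> D"
      then obtain d where d: "d > 0" "\<And>h. 0 < h \<Longrightarrow> h < d \<Longrightarrow>
          L y t / (\<alpha> t)\<^sup>2 < L y (t - h) / (\<alpha> (t - h))\<^sup>2"
        using DERIV_neg_dec_left[OF D] unfolding L_def by force
      define h where "h = min d t / 2"
      have h: "0 < h" "h < d" "h < t" using d t by (auto simp: h_def)
      have "F y t < F y (t - h)"
        unfolding F_def using d(2)[OF h(1,2)] \<psi>y by (rule mult_strict_left_mono)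
      moreover have "F y (t - h) \<le> M"
      proof (cases "t - h < \<epsilon>")
        case True
        then show ?thesis using early[of "t - h" y] h t \<psi>y MC C0 by auto
      next
        case False
        then show ?thesis using FM[OF y(1), of "t - h"] h t by auto
      qed
      ultimately show False using Ft by simp
    qed
  qed
  then have "H \<le> (n * (2 / (R * \<psi> y) * (Dom * Dmu))) * (\<alpha> t)\<^sup>2"
    by (simp only: mult_ac)
  then have "L y t / (\<alpha> t)\<^sup>2 \<le> n * (2 / (R * \<psi> y) * (Dom * Dmu))"
    unfolding H_def using \<alpha>2 by (simp only: pos_divide_le_eq)
  then have "F y t \<le> \<psi> y * (n * (2 / (R * \<psi> y) * (Dom * Dmu)))"
    unfolding F_def using \<psi>y by (intro mult_left_mono) auto
  also have "\<dots> = 2 * n * (Dom * Dmu) / R" using \<psi>y by simp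
  finally show False using C_ge Ft MC by simp
qed

end

section \<open>Comparison of weights\<close>

text \<open>The integrand need not be continuous at \<open>0\<close>, so derivatives are available
  on the open half line only, and a right limit supplies the initial value.\<close>

lemma indefinite_integral_half_line:
  fixes g :: "real \<Rightarrow> real"
  assumes int: "\<And>L. L > 0 \<Longrightarrow> g integrable_on {0..L}" and cont: "\<And>t. t > 0 \<Longrightarrow> isCont g t"
  shows "t > 0 \<Longrightarrow> ((\<lambda>t. integral {0..t} g) has_real_derivative g t) (at t)"
    and "((\<lambda>t. integral {0..t} g) \<longlongrightarrow> 0) (at_right 0)"
proof -
  assume t: "t > 0"
  have "((\<lambda>t. integral {0..t} g) has_vector_derivative g t) (at t within {0..t + 1})"
    using t integral_has_vector_derivative_continuous_at[of g 0 "t + 1" t "{}"]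
    by (simp add: int cont continuous_at_imp_continuous_at_within)
  moreover have "at t within {0..t + 1} = at t"
    using t by (intro at_within_interior) auto
  ultimately show "((\<lambda>t. integral {0..t} g) has_real_derivative g t) (at t)"
    by (simp add: has_real_derivative_iff_has_vector_derivative)
next
  have "continuous_on {0..1} (\<lambda>t. integral {0..t} g)"
    by (intro indefinite_integral_continuous_1 int) simp
  from this[unfolded continuous_on, rule_format, of 0]
  have "((\<lambda>t. integral {0..t} g) \<longlongrightarrow> integral {0..0} g) (at 0 within {0..1})" by simp
  moreover have "at 0 within {0..1} = at_right (0::real)"
    by (rule at_within_Icc_at_right) simp
  ultimately show "((\<lambda>t. integral {0..t} g) \<longlongrightarrow> 0) (at_right 0)" by simp
qed

lemma limit_le_of_deriv_nonneg:
  fixes h :: "real \<Rightarrow> real"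
  assumes T: "0 < T"
    and dh: "\<And>t. 0 < t \<Longrightarrow> t \<le> T \<Longrightarrow> (h has_real_derivative h' t) (at t)"
    and lim: "(h \<longlongrightarrow> l) (at_right 0)"
    and nonneg: "\<And>t. 0 < t \<Longrightarrow> t \<le> T \<Longrightarrow> 0 \<le> h' t"
  shows "l \<le> h T"
proof (rule tendsto_upperbound[OF lim])
  have "h s \<le> h T" if s: "0 < s" "s \<le> T" for s
    using s(2)
  proof (rule DERIV_nonneg_imp_nondecreasing)
    fix t assume "s \<le> t" "t \<le> T"
    then show "\<exists>y. DERIV h t :> y \<and> 0 \<le> y"
      using dh[of t] nonneg[of t] s by (intro exI conjI) auto
  qed
  then show "\<forall>\<^sub>F s in at_right 0. h s \<le> h T"
    using T by (auto simp: eventually_at_right_field intro!: exI[of _ T])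
qed simp

context oscillator
begin

text \<open>
  For \<open>y = \<surd>a\<close> this is the Jacobi bound \<open>\<integral> y'\<^sup>2 + lam y\<^sup>2 \<ge> r y\<^sup>2\<close>, in which equality holds for
  \<open>y = b\<close>. The shift by \<open>\<delta>\<close> keeps \<open>r\<close> bounded near \<open>0\<close>.
\<close>

lemma riccati_comparison:
  fixes a :: "real \<Rightarrow> real"
  assumes T: "0 < T" "T < S"
    and da: "\<And>t. t > 0 \<Longrightarrow> (a has_real_derivative a' t) (at t)"
    and a_pos: "\<And>t. t > 0 \<Longrightarrow> a t > 0"
    and a_lim: "(a \<longlongrightarrow> 0) (at_right 0)"
    and a_int: "\<And>L. L > 0 \<Longrightarrow> a integrable_on {0..L}"
    and q_int: "\<And>L. L > 0 \<Longrightarrow> (\<lambda>s. (a' s)\<^sup>2 / a s) integrable_on {0..L}"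
    and q_cont: "\<And>t. t > 0 \<Longrightarrow> isCont (\<lambda>s. (a' s)\<^sup>2 / a s) t"
  shows "r T * a T - lam * integral {0..T} a \<le> integral {0..T} (\<lambda>s. (a' s)\<^sup>2 / a s) / 4"
proof -
  define Ia where "Ia = (\<lambda>t. integral {0..t} a)"
  define Q where "Q = (\<lambda>t. integral {0..t} (\<lambda>s. (a' s)\<^sup>2 / a s))"
  have a_cont: "isCont a t" if "t > 0" for t using da[OF that] DERIV_isCont by blast
  note dIa = indefinite_integral_half_line(1)[OF a_int a_cont, folded Ia_def]
  note lIa = indefinite_integral_half_line(2)[OF a_int a_cont, folded Ia_def]
  note dQ = indefinite_integral_half_line(1)[OF q_int q_cont, folded Q_def]
  note lQ = indefinite_integral_half_line(2)[OF q_int q_cont, folded Q_def]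
  have shifted: "r (T + \<delta>) * a T \<le> lam * Ia T + Q T / 4" if \<delta>: "0 < \<delta>" "\<delta> < S - T" for \<delta>
  proof -
    define h where "h = (\<lambda>t. lam * Ia t + Q t / 4 - r (t + \<delta>) * a t)"
    \<comment> \<open>With \<open>y = sqrt a\<close> this derivative is
      \<open>(y' - r y)\<^sup>2\<close>, where \<open>r\<close> is taken at
      \<open>t + \<delta>\<close>: the Riccati equation completes the square.\<close>
    have dh: "(h has_real_derivative (a' t - 2 * r (t + \<delta>) * a t)\<^sup>2 / (4 * a t)) (at t)"
      if t: "0 < t" "t \<le> T" for t
    proof -
      have d: "((\<lambda>t. r (t + \<delta>)) has_real_derivative lam - (r (t + \<delta>))\<^sup>2) (at t)"
        using dr[of "t + \<delta>"] t \<delta> by (simp add: DERIV_shift)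
      have "(h has_real_derivative lam * a t + ((a' t)\<^sup>2 / a t) / 4
          - ((lam - (r (t + \<delta>))\<^sup>2) * a t + a' t * r (t + \<delta>))) (at t)"
        unfolding h_def
        by (intro DERIV_diff DERIV_add DERIV_cmult DERIV_cdivide dIa dQ DERIV_mult d da t)
      moreover have "lam * a t + ((a' t)\<^sup>2 / a t) / 4 - ((lam - (r (t + \<delta>))\<^sup>2) * a t + a' t * r (t + \<delta>))
          = (a' t - 2 * r (t + \<delta>) * a t)\<^sup>2 / (4 * a t)"
        using a_pos[OF t(1)] by (simp add: field_simps power2_eq_square)
      ultimately show ?thesis by simp
    qed
    have "(h \<longlongrightarrow> lam * 0 + 0 / 4 - r (0 + \<delta>) * 0) (at_right 0)"
      unfolding h_def
    proof (intro tendsto_intros lIa lQ a_lim)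
      have "isCont (\<lambda>t. r (t + \<delta>)) 0"
        using isCont_r[of \<delta>] \<delta> T by (intro isCont_o2[of "0::real" "\<lambda>t. t + \<delta>" r]) auto
      then show "((\<lambda>t. r (t + \<delta>)) \<longlongrightarrow> r (0 + \<delta>)) (at_right 0)"
        by (simp add: isCont_def filterlim_at_split)
    qed auto
    with T(1) dh have "lam * 0 + 0 / 4 - r (0 + \<delta>) * 0 \<le> h T"
      by (rule limit_le_of_deriv_nonneg) (auto intro!: divide_nonneg_nonneg less_imp_le[OF a_pos])
    then show ?thesis by (simp add: h_def)
  qed
  have "((\<lambda>\<delta>. r (T + \<delta>) * a T) \<longlongrightarrow> r T * a T) (at_right 0)"
  proof (intro tendsto_intros)
    have "isCont (\<lambda>\<delta>. r (T + \<delta>)) 0"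
      using isCont_r[OF T] by (intro isCont_o2[of "0::real" "\<lambda>\<delta>. T + \<delta>" r]) auto
    then show "((\<lambda>\<delta>. r (T + \<delta>)) \<longlongrightarrow> r T) (at_right 0)"
      by (simp add: isCont_def filterlim_at_split)
  qed
  moreover have "\<forall>\<^sub>F \<delta> in at_right 0. r (T + \<delta>) * a T \<le> lam * Ia T + Q T / 4"
    using shifted T by (auto simp: eventually_at_right_field intro!: exI[of _ "S - T"])
  ultimately have "r T * a T \<le> lam * Ia T + Q T / 4"
    by (intro tendsto_upperbound[of "\<lambda>\<delta>. r (T + \<delta>) * a T"]) auto
  then show ?thesis by (simp add: Ia_def Q_def)
qed

end

section \<open>The three model oscillators and the quotients they attain\<close>

lemma oscillator_sin:
  assumes "\<omega> > 0"
  shows "oscillator (- \<omega>\<^sup>2) (pi / \<omega>) (\<lambda>t. sin (\<omega> * t) / \<omega>) (\<lambda>t. cos (\<omega> * t))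
    (\<lambda>t. (t - sin (\<omega> * t) * cos (\<omega> * t) / \<omega>) / (2 * \<omega>\<^sup>2))"
proof
  show "((\<lambda>t. (t - sin (\<omega> * t) * cos (\<omega> * t) / \<omega>) / (2 * \<omega>\<^sup>2)) has_real_derivative
      (sin (\<omega> * t) / \<omega>)\<^sup>2) (at t)" for t
  proof -
    have "1 - (cos (\<omega> * t) * cos (\<omega> * t) - sin (\<omega> * t) * sin (\<omega> * t)) = 2 * (sin (\<omega> * t))\<^sup>2"
      using sin_cos_squared_add[of "\<omega> * t"] by (simp add: power2_eq_square algebra_simps)
    moreover have "((\<lambda>t. (t - sin (\<omega> * t) * cos (\<omega> * t) / \<omega>) / (2 * \<omega>\<^sup>2)) has_real_derivative
        (1 - (cos (\<omega> * t) * cos (\<omega> * t) - sin (\<omega> * t) * sin (\<omega> * t))) / (2 * \<omega>\<^sup>2)) (at t)"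
      using assms by (auto intro!: derivative_eq_intros simp: field_simps)
    ultimately show ?thesis by (simp add: power_divide)
  qed
  show "0 < sin (\<omega> * t) / \<omega>" if "0 < t" "t < pi / \<omega>" for t
    using that assms by (intro divide_pos_pos sin_gt_zero) (auto simp: field_simps)
qed (use assms in \<open>auto intro!: derivative_eq_intros simp: power2_eq_square\<close>)

lemma oscillator_sinh:
  assumes "\<omega> > 0"
  shows "oscillator (\<omega>\<^sup>2) S (\<lambda>t. sinh (\<omega> * t) / \<omega>) (\<lambda>t. cosh (\<omega> * t))
    (\<lambda>t. (sinh (\<omega> * t) * cosh (\<omega> * t) / \<omega> - t) / (2 * \<omega>\<^sup>2))"
proof
  show "((\<lambda>t. (sinh (\<omega> * t) * cosh (\<omega> * t) / \<omega> - t) / (2 * \<omega>\<^sup>2)) has_real_derivative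
      (sinh (\<omega> * t) / \<omega>)\<^sup>2) (at t)" for t
  proof -
    have "(cosh (\<omega> * t) * cosh (\<omega> * t) + sinh (\<omega> * t) * sinh (\<omega> * t)) - 1 = 2 * (sinh (\<omega> * t))\<^sup>2"
      using hyperbolic_pythagoras[of "\<omega> * t"] by (simp add: power2_eq_square algebra_simps)
    then show ?thesis
      using assms
      by (auto intro!: derivative_eq_intros simp: field_simps power2_eq_square)
  qed
qed (use assms in \<open>auto intro!: derivative_eq_intros simp: power2_eq_square\<close>)

lemma oscillator_linear: "oscillator 0 S (\<lambda>t. t) (\<lambda>t. 1) (\<lambda>t. t ^ 3 / 3)"
  by unfold_locales (auto intro!: derivative_eq_intros simp: power2_eq_square)

text \<open>By scaling, the quotient is \<open>T * g (\<omega> * T)\<close> with \<open>g\<close>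
  depending on the family only. For \<open>sinh\<close>, \<open>g\<close> has the limits
  \<open>1 / 3\<close> at \<open>0\<close> and \<open>0\<close> at infinity; for \<open>sin\<close>
  it starts from \<open>1 / 3\<close> and exceeds \<open>1\<close> before \<open>pi\<close>; the
  identity gives exactly \<open>1 / 3\<close>. The intermediate value theorem yields
  \<omega>.\<close>

lemma oscillator_exists:
  assumes T: "0 < T" and \<iota>: "0 < \<iota>" "\<iota> \<le> T"
  shows "\<exists>lam S b c A. oscillator lam S b c A \<and> T < S \<and> A T / (b T)\<^sup>2 = \<iota>"
proof -
  consider "\<iota> / T < 1 / 3" | "\<iota> / T = 1 / 3" | "\<iota> / T > 1 / 3" by linarith
  then show ?thesis
  proof cases
    case 1
    define g :: "real \<Rightarrow> real" where "g = (\<lambda>z. (sinh z * cosh z / z - 1) / (2 * (sinh z)\<^sup>2))"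
    have "(g \<longlongrightarrow> 1 / 3) (at_right 0)" "(g \<longlongrightarrow> 0) at_top"
      unfolding g_def sinh_field_def cosh_field_def by real_asymp+
    then have "\<forall>\<^sub>F z in at_right 0. \<iota> / T < g z" "\<forall>\<^sub>F z in at_top. g z < \<iota> / T"
      using 1 T \<iota> by (auto intro: order_tendstoD)
    then obtain z1 z2 where z1: "0 < z1" "\<And>z. 0 < z \<Longrightarrow> z < z1 \<Longrightarrow> \<iota> / T < g z"
      and z2: "\<And>z. z2 \<le> z \<Longrightarrow> g z < \<iota> / T"
      by (auto simp: eventually_at_right_field eventually_at_top_linorder)
    have "\<exists>z\<ge>z1 / 2. z \<le> max z1 z2 \<and> g z = \<iota> / T"
    proof (rule IVT2')
      show "g (max z1 z2) \<le> \<iota> / T" using z2[of "max z1 z2"] by simp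
      show "\<iota> / T \<le> g (z1 / 2)" using z1(2)[of "z1 / 2"] z1(1) by simp
      show "continuous_on {z1 / 2..max z1 z2} g"
        unfolding g_def using z1(1) by (intro continuous_intros) auto
    qed (use z1 in auto)
    then obtain z where z: "z1 / 2 \<le> z" "g z = \<iota> / T" by blast
    have "z > 0" using z z1(1) by linarith
    note z = this z(2)
    define \<omega> where "\<omega> = z / T"
    have \<omega>: "\<omega> > 0" "\<omega> * T = z" using z T by (auto simp: \<omega>_def)
    have "(sinh z * cosh z / \<omega> - T) / (2 * \<omega>\<^sup>2) / (sinh z / \<omega>)\<^sup>2 = T * g z"
      using z T by (simp add: g_def \<omega>_def field_simps power2_eq_square)
    also have "\<dots> = \<iota>" using z T by simp
    finally show ?thesis
      using oscillator_sinh[OF \<omega>(1), of "T + 1"] \<omega>(2) by (intro exI conjI) auto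
  next
    case 2
    then have "T ^ 3 / 3 / T\<^sup>2 = \<iota>" using T by (simp add: field_simps power2_eq_square power3_eq_cube)
    then show ?thesis
      using oscillator_linear[of "T + 1"] by (intro exI[of _ "T + 1"] exI conjI) auto
  next
    case 3
    define g :: "real \<Rightarrow> real" where "g = (\<lambda>z. (1 - sin z * cos z / z) / (2 * (sin z)\<^sup>2))"
    have "(g \<longlongrightarrow> 1 / 3) (at_right 0)"
      unfolding g_def by real_asymp
    then have "\<forall>\<^sub>F z in at_right 0. g z < \<iota> / T"
      using 3 by (auto intro: order_tendstoD)
    then obtain z1 where z1: "0 < z1" "\<And>z. 0 < z \<Longrightarrow> z < z1 \<Longrightarrow> g z < \<iota> / T"
      by (auto simp: eventually_at_right_field)
    define z0 where "z0 = min (z1 / 2) (pi / 4)"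
    have z0: "0 < z0" "z0 < z1" "z0 \<le> pi / 4" using z1(1) by (auto simp: z0_def)
    \<comment> \<open>At \<open>3 * pi / 4\<close> the sine is still positive and \<open>g\<close>
      equals \<open>1 + 2 / (3 * pi)\<close>, which exceeds \<open>\<iota> / T\<close> because of
      \<open>\<iota> \<le> T\<close>.\<close>
    have "\<exists>z\<ge>z0. z \<le> 3 * pi / 4 \<and> g z = \<iota> / T"
    proof (rule IVT')
      show "g z0 \<le> \<iota> / T" using z1(2)[of z0] z0 by simp
      have "sin (3 * pi / 4) = sqrt 2 / 2" "cos (3 * pi / 4) = - (sqrt 2 / 2)"
        using sin_add[of "pi / 2" "pi / 4"] cos_add[of "pi / 2" "pi / 4"]
        by (simp_all add: sin_45 cos_45)
      then have "sin (3 * pi / 4) * cos (3 * pi / 4) = - (1 / 2)" "(sin (3 * pi / 4))\<^sup>2 = 1 / 2"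
        by (simp_all only:) (simp_all add: power2_eq_square)
      then have "g (3 * pi / 4) = 1 + 2 / (3 * pi)"
        unfolding g_def by (simp only:) (simp add: field_simps)
      moreover have "\<iota> / T \<le> 1" using T \<iota> by simp
      moreover have "0 \<le> 2 / (3 * pi)" by simp
      ultimately show "\<iota> / T \<le> g (3 * pi / 4)" by linarith
      show "z0 \<le> 3 * pi / 4" using z0 pi_gt_zero by linarith
      have "sin z > 0" if "z \<in> {z0..3 * pi / 4}" for z
        using that z0 pi_gt_zero by (intro sin_gt_zero) auto
      then show "continuous_on {z0..3 * pi / 4} g"
        unfolding g_def using z0(1) by (intro continuous_intros) force+
    qed
    then obtain z where z: "z0 \<le> z" "z \<le> 3 * pi / 4" "g z = \<iota> / T" by blast
    have "z > 0" "z < pi" using z z0(1) pi_gt_zero by linarith+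
    note z = this z(3)
    define \<omega> where "\<omega> = z / T"
    have \<omega>: "\<omega> > 0" "\<omega> * T = z" using z T by (auto simp: \<omega>_def)
    have sz: "sin z > 0" using z by (intro sin_gt_zero) auto
    have "(T - sin z * cos z / \<omega>) / (2 * \<omega>\<^sup>2) / (sin z / \<omega>)\<^sup>2 = T * g z"
      using z T sz by (simp add: g_def \<omega>_def field_simps power2_eq_square)
    also have "\<dots> = \<iota>" using z T by simp
    finally have "(T - sin z * cos z / \<omega>) / (2 * \<omega>\<^sup>2) / (sin z / \<omega>)\<^sup>2 = \<iota>" .
    moreover have "T < pi / \<omega>" using z T by (simp add: \<omega>_def field_simps)
    ultimately show ?thesis
      using oscillator_sin[OF \<omega>(1)] \<omega>(2) by (intro exI conjI) auto
  qed
qed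

section \<open>The cutoff function\<close>

lemma graph_dist_le_iff: "graph_dist adj x y \<le> enat k \<longleftrightarrow> (\<exists>j\<le>k. (adj ^^ j) x y)"
proof
  assume le: "graph_dist adj x y \<le> enat k"
  let ?D = "enat ` {j. (adj ^^ j) x y}"
  have "?D \<noteq> {}"
  proof
    assume "?D = {}"
    then have "graph_dist adj x y = \<infinity>" by (simp add: graph_dist_def top_enat_def)
    then show False using le by simp
  qed
  then have "Inf ?D \<in> ?D" by (meson wellorder_InfI ex_in_conv)
  then show "\<exists>j\<le>k. (adj ^^ j) x y" using le unfolding graph_dist_def by force
next
  assume "\<exists>j\<le>k. (adj ^^ j) x y"
  then obtain j where "j \<le> k" "(adj ^^ j) x y" by blast
  then have "graph_dist adj x y \<le> enat j" unfolding graph_dist_def by (intro INF_lower) simp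
  also have "\<dots> \<le> enat k" using \<open>j \<le> k\<close> by simp
  finally show "graph_dist adj x y \<le> enat k" .
qed

lemma graph_dist_step:
  assumes "adj x y"
  shows "graph_dist adj x z \<le> graph_dist adj y z + 1"
proof (cases "graph_dist adj y z")
  case (enat k)
  then obtain j where "j \<le> k" "(adj ^^ j) y z" using graph_dist_le_iff[of adj y z k] by auto
  then have "(adj ^^ Suc j) x z" using assms by (meson relpowp_Suc_I2)
  then have "graph_dist adj x z \<le> enat (Suc k)"
    using \<open>j \<le> k\<close> unfolding graph_dist_le_iff by (intro exI[of _ "Suc j"]) simp
  then show ?thesis by (simp add: enat one_enat_def)
qed simp

text \<open>Not truncated at \<open>0\<close>: its sign marks the ball of radius
  \<open>2 * R\<close>. The negative value at infinite distance puts other components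
  outside.\<close>

definition cutoff :: "('a \<Rightarrow> 'a \<Rightarrow> bool) \<Rightarrow> 'a \<Rightarrow> real \<Rightarrow> 'a \<Rightarrow> real" where
  "cutoff adj x\<^sub>0 R x =
     (case graph_dist adj x x\<^sub>0 of enat k \<Rightarrow> min 1 (2 - real k / R) | \<infinity> \<Rightarrow> - 1)"

lemma cutoff_nonneg_iff:
  assumes "R > 0"
  shows "0 \<le> cutoff adj x\<^sub>0 R x \<longleftrightarrow> x \<in> graph_cball adj x\<^sub>0 (2 * R)"
  using assms by (cases "graph_dist adj x x\<^sub>0") (auto simp: cutoff_def graph_cball_def field_simps)

lemma cutoff_eq_1:
  assumes "R > 0" "x \<in> graph_cball adj x\<^sub>0 R"
  shows "cutoff adj x\<^sub>0 R x = 1"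
  using assms by (cases "graph_dist adj x x\<^sub>0") (auto simp: cutoff_def graph_cball_def field_simps)

context weighted_graph
begin

lemma cutoff_lipschitz:
  assumes R: "R > 0" and xy: "adj x y"
  shows "cutoff adj x\<^sub>0 R x \<le> cutoff adj x\<^sub>0 R y + 1 / R"
proof -
  have 1: "graph_dist adj x x\<^sub>0 \<le> graph_dist adj y x\<^sub>0 + 1"
    and 2: "graph_dist adj y x\<^sub>0 \<le> graph_dist adj x x\<^sub>0 + 1"
    by (rule graph_dist_step xy adj_sym)+
  show ?thesis
  proof (cases "graph_dist adj x x\<^sub>0")
    case (enat k)
    moreover obtain l where l: "graph_dist adj y x\<^sub>0 = enat l"
      using 2 enat by (cases "graph_dist adj y x\<^sub>0") (auto simp: one_enat_def)
    moreover have "real l / R \<le> (real k + 1) / R"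
      using 2 R unfolding enat l by (intro divide_right_mono) (auto simp: one_enat_def)
    moreover have "0 \<le> 1 / R" using R by simp
    ultimately show ?thesis
      by (simp only: cutoff_def enat.case add_divide_distrib)
  next
    case infinity
    then show ?thesis
      using 1 R by (cases "graph_dist adj y x\<^sub>0") (auto simp: cutoff_def one_enat_def)
  qed
qed

lemma finite_walk_sources: "finite {x. (adj ^^ k) x x\<^sub>0}"
proof (induction k)
  case (Suc k)
  have "{x. (adj ^^ Suc k) x x\<^sub>0} \<subseteq> (\<Union>z\<in>{z. (adj ^^ k) z x\<^sub>0}. {x. adj z x})"
    using adj_sym by (fastforce dest: relpowp_Suc_D2)
  then show ?case by (rule finite_subset) (use Suc locally_finite in blast)
qed simp

lemma finite_graph_cball: "finite (graph_cball adj x\<^sub>0 \<rho>)"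
proof (rule finite_subset)
  show "graph_cball adj x\<^sub>0 \<rho> \<subseteq> (\<Union>k\<le>nat \<lfloor>\<rho>\<rfloor>. {x. (adj ^^ k) x x\<^sub>0})"
  proof
    fix x assume "x \<in> graph_cball adj x\<^sub>0 \<rho>"
    then obtain k where k: "graph_dist adj x x\<^sub>0 = enat k" "real k \<le> \<rho>"
      by (cases "graph_dist adj x x\<^sub>0") (auto simp: graph_cball_def)
    then have "graph_dist adj x x\<^sub>0 \<le> enat (nat \<lfloor>\<rho>\<rfloor>)" by (simp add: le_nat_floor)
    then show "x \<in> (\<Union>k\<le>nat \<lfloor>\<rho>\<rfloor>. {x. (adj ^^ k) x x\<^sub>0})"
      unfolding graph_dist_le_iff by auto
  qed
qed (auto intro: finite_walk_sources)

section \<open>The gradient estimate\<close>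

text \<open>The estimate for the weight \<open>b\<^sup>2\<close>. The differential equations
  required by \<open>li_yau_cutoff\<close> follow from \<open>dI\<close> and \<open>dr\<close>, and
  \<alpha>' \<ge> 0 from \<open>dI_nonneg\<close>.\<close>

lemma li_yau_oscillator:
  fixes u :: "real \<Rightarrow> 'a \<Rightarrow> real"
  assumes osc: "oscillator lam S b c A" and T: "0 < T" "T < S"
    and cde: "CDE adj w \<mu> n (- K)" and n: "n > 0" and K: "K \<ge> 0" and R: "R > 0"
    and u_pos: "\<And>y s. u s y > 0"
    and du: "\<And>y t. y \<in> graph_cball adj x\<^sub>0 (2 * R) \<Longrightarrow>
      ((\<lambda>s. u s y) has_real_derivative Lap (u t) y) (at t)"
    and x: "x \<in> graph_cball adj x\<^sub>0 R"
  defines "\<iota> \<equiv> A T / (b T)\<^sup>2"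
  shows "li_yau (1 + 2 * K * \<iota>) (n * K + n * K\<^sup>2 * \<iota> + n * (c T / b T - lam * \<iota>)) (u T) x
    \<le> 2 * n * Dmu * (1 + Dom) * (1 + 2 * K * \<iota>)\<^sup>2 / R"
proof -
  interpret o: oscillator lam S b c A by fact
  define \<alpha> where "\<alpha> = (\<lambda>t. 1 + 2 * K * o.I t)"
  define \<phi> where "\<phi> = (\<lambda>t. n * K + n * K\<^sup>2 * o.I t + n * (o.r t - lam * o.I t))"
  have "cutoff adj x\<^sub>0 R x * li_yau (\<alpha> T) (\<phi> T) (u T) x \<le> 2 * n * Dmu * (1 + Dom) * (\<alpha> T)\<^sup>2 / R"
  proof (rule li_yau_cutoff[where r=o.r and u=u and \<alpha>=\<alpha> and \<phi>=\<phi> and \<psi>="cutoff adj x\<^sub>0 R" and T=T and x=x,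
        OF cde n K R])
    show "0 < u s y" for s y by (rule u_pos)
    show "((\<lambda>s. u s y) has_real_derivative Lap (u t) y) (at t)" if "0 \<le> cutoff adj x\<^sub>0 R y" for y t
      using du that R by (simp add: cutoff_nonneg_iff)
    show "cutoff adj x\<^sub>0 R y \<le> cutoff adj x\<^sub>0 R z + 1 / R" if "adj y z" for y z
      by (rule cutoff_lipschitz[OF R that])
    show "finite {y. 0 \<le> cutoff adj x\<^sub>0 R y}"
      using finite_graph_cball[of x\<^sub>0 "2 * R"] R by (simp add: cutoff_nonneg_iff)
    show "0 < T" by fact
    show "0 \<le> cutoff adj x\<^sub>0 R x" by (simp add: cutoff_eq_1[OF R x])
    show "filterlim \<phi> at_top (at_right 0)"
    proof -
      have "filterlim (\<lambda>t. n * (o.r t - lam * o.I t)) at_top (at_right 0)"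
        using o.r_lim T n by (intro filterlim_tendsto_pos_mult_at_top[OF tendsto_const]) auto
      moreover have "\<forall>\<^sub>F t in at_right 0. n * (o.r t - lam * o.I t) \<le> \<phi> t"
        using n K by (auto simp: \<phi>_def eventually_at_right_field o.I_nonneg intro!: exI[of _ 1])
      ultimately show ?thesis by (rule filterlim_at_top_mono)
    qed
  next
    fix t assume t: "0 < t" "t \<le> T"
    then have tS: "t < S" using T by simp
    note dI = o.dI[OF t(1) tS] and dr = o.dr[OF t(1) tS]
    show "(\<alpha> has_real_derivative 2 * (K + o.r t) - 2 * o.r t * \<alpha> t) (at t)"
      unfolding \<alpha>_def by (rule derivative_eq_intros dI refl)+ (simp add: algebra_simps)
    show "(\<phi> has_real_derivative n * (K + o.r t)\<^sup>2 - 2 * o.r t * \<phi> t) (at t)"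
      unfolding \<phi>_def
      by (rule derivative_eq_intros dI dr refl)+ (simp add: algebra_simps power2_eq_square)
    have I: "0 \<le> o.I t" using t by (intro o.I_nonneg) simp
    show "1 \<le> \<alpha> t" using I K by (simp add: \<alpha>_def)
    have "0 \<le> 2 * K * (1 - 2 * o.r t * o.I t)"
      using o.dI_nonneg[OF t(1) tS] K by simp
    also have "\<dots> = 2 * (K + o.r t) - 2 * o.r t * \<alpha> t" by (simp add: \<alpha>_def algebra_simps)
    finally show "0 \<le> 2 * (K + o.r t) - 2 * o.r t * \<alpha> t" .
    have "0 \<le> n * (o.r t - lam * o.I t)" using o.r_ge[OF t(1) tS] n by simp
    moreover have "n * K * (\<alpha> t + 1) / 2 = n * K + n * K\<^sup>2 * o.I t"
      by (simp add: \<alpha>_def field_simps power2_eq_square)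
    ultimately show "n * K * (\<alpha> t + 1) / 2 \<le> \<phi> t" by (simp add: \<phi>_def)
  qed
  then show ?thesis
    by (simp add: cutoff_eq_1[OF R x] \<alpha>_def \<phi>_def \<iota>_def o.I_def o.r_def)
qed

text \<open>The oscillator depends on \<open>T\<close>: its quotient is matched with that of
  \<open>a\<close>, which preserves \<open>alpha\<close> at time \<open>T\<close>. By
  \<open>riccati_comparison\<close> its \<phi> is at most \<open>phi\<close>, and
  \<open>li_yau\<close> decreases in \<phi>.\<close>

lemma li_yau_weight:
  fixes u :: "real \<Rightarrow> 'a \<Rightarrow> real" and a :: "real \<Rightarrow> real"
  assumes cde: "CDE adj w \<mu> n (- K)" and n: "n > 0" and K: "K \<ge> 0" and R: "R > 0" and T: "T > 0"
    and u_pos: "\<And>y s. u s y > 0"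
    and du: "\<And>y t. y \<in> graph_cball adj x\<^sub>0 (2 * R) \<Longrightarrow>
      ((\<lambda>s. u s y) has_real_derivative Lap (u t) y) (at t)"
    and x: "x \<in> graph_cball adj x\<^sub>0 R"
    and a_diff: "\<And>t. t > 0 \<Longrightarrow> a differentiable (at t)"
    and a_pos: "\<And>t. t > 0 \<Longrightarrow> a t > 0"
    and a_deriv_pos: "\<And>t. t > 0 \<Longrightarrow> deriv a t > 0"
    and a_lim: "(a \<longlongrightarrow> 0) (at_right 0)"
    and q_cont: "\<And>L. L > 0 \<Longrightarrow> continuous_on {0<..L} (\<lambda>s. (deriv a s)\<^sup>2 / a s)"
    and q_int: "\<And>L. L > 0 \<Longrightarrow> (\<lambda>s. (deriv a s)\<^sup>2 / a s) integrable_on {0..L}"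
  shows "li_yau (alpha K a T) (phi n K a T) (u T) x
    \<le> 2 * n * Dmu * (1 + Dom) * (alpha K a T)\<^sup>2 / R"
proof -
  have da: "(a has_real_derivative deriv a t) (at t)" if "t > 0" for t
    using a_diff[OF that] by (simp add: DERIV_deriv_iff_real_differentiable)
  have mono: "a s \<le> a t" if "0 < s" "s \<le> t" for s t
    using that(2)
  proof (rule DERIV_nonneg_imp_nondecreasing)
    fix z assume "s \<le> z" "z \<le> t"
    then show "\<exists>y. DERIV a z :> y \<and> 0 \<le> y"
      using da[of z] a_deriv_pos[of z] that by (intro exI conjI) auto
  qed
  have a_int: "a integrable_on {0..L}" if L: "L > 0" for L
  proof -
    \<comment> \<open>\<open>a 0\<close> is arbitrary; setting the value there to \<open>0\<close>
      gives a continuous function on \<open>{0..L}\<close> without affecting the integral.\<close>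
    define g where "g = (\<lambda>t. if t = 0 then 0 else a t)"
    have "continuous (at t within {0..L}) g" if t: "t \<in> {0..L}" for t
    proof (cases "t = 0")
      case True
      have "(g \<longlongrightarrow> 0) (at_right 0)"
        by (rule Lim_transform_eventually[OF a_lim]) (auto simp: g_def eventually_at_filter)
      then have "(g \<longlongrightarrow> 0) (at 0 within {0..L})"
        using L by (simp add: at_within_Icc_at_right)
      then show ?thesis by (simp add: True continuous_within g_def)
    next
      case False
      then have "t > 0" using t by simp
      then have "isCont a t" using da DERIV_isCont by blast
      moreover have "\<forall>\<^sub>F s in nhds t. a s = g s"
      proof (rule eventually_mono)
        show "\<forall>\<^sub>F s in nhds t. s \<in> {0<..}"
          using \<open>t > 0\<close> by (intro eventually_nhds_in_open) auto
      qed (simp add: g_def)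
      ultimately have "isCont g t" using isCont_cong by fastforce
      then show ?thesis by (rule continuous_at_imp_continuous_at_within)
    qed
    then have "g integrable_on {0..L}"
      by (intro integrable_continuous_real) (simp add: continuous_on_eq_continuous_within)
    then show ?thesis
      by (rule integrable_spike[where S="{0}"]) (auto simp: g_def)
  qed
  have q_cont': "isCont (\<lambda>s. (deriv a s)\<^sup>2 / a s) t" if "t > 0" for t
  proof -
    have "continuous_on {0<..<t + 1} (\<lambda>s. (deriv a s)\<^sup>2 / a s)"
      by (rule continuous_on_subset[OF q_cont[of "t + 1"]]) (use that in auto)
    then show ?thesis using that by (simp add: continuous_on_eq_continuous_at)
  qed
  define \<iota> where "\<iota> = integral {0..T} a / a T"
  have aT: "a T > 0" by (rule a_pos[OF T])
  have a_cont: "isCont a t" if "t > 0" for t using da[OF that] DERIV_isCont by blast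
  define Ia where "Ia = (\<lambda>t. integral {0..t} a)"
  note dIa = indefinite_integral_half_line(1)[OF a_int a_cont, folded Ia_def]
  note lIa = indefinite_integral_half_line(2)[OF a_int a_cont, folded Ia_def]
  have "0 \<le> Ia (T / 2)"
    by (rule limit_le_of_deriv_nonneg[of _ _ a, OF _ dIa lIa]) (use T a_pos in \<open>auto intro: less_imp_le\<close>)
  also have "Ia (T / 2) < Ia T"
  proof (rule DERIV_pos_imp_increasing[where f=Ia])
    fix t assume "T / 2 \<le> t" "t \<le> T"
    then show "\<exists>y. DERIV Ia t :> y \<and> 0 < y"
      using dIa[of t] a_pos[of t] T by (intro exI conjI) auto
  qed (use T in simp)
  finally have Ia_pos: "0 < Ia T" .
  \<comment> \<open>The bound \<open>\<iota> \<le> T\<close> needed for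
    \<open>oscillator_exists\<close> expresses that \<open>a\<close> is nondecreasing.\<close>
  have "0 * a T - 0 \<le> T * a T - Ia T"
  proof (rule limit_le_of_deriv_nonneg[OF T, where h="\<lambda>t. t * a T - Ia t" and h'="\<lambda>t. a T - a t"])
    show "((\<lambda>t. t * a T - Ia t) has_real_derivative a T - a t) (at t)" if "0 < t" for t
      using that by (auto intro!: derivative_eq_intros dIa)
    show "((\<lambda>t. t * a T - Ia t) \<longlongrightarrow> 0 * a T - 0) (at_right 0)"
      by (intro tendsto_intros lIa)
  qed (use mono in auto)
  then have \<iota>: "0 < \<iota>" "\<iota> \<le> T"
    using Ia_pos aT by (auto simp: \<iota>_def Ia_def divide_le_eq)
  obtain lam S b c A where osc: "oscillator lam S b c A" and TS: "T < S" and eq: "A T / (b T)\<^sup>2 = \<iota>"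
    using oscillator_exists[OF T \<iota>] by blast
  interpret o: oscillator lam S b c A by fact
  have le: "o.r T * a T - lam * integral {0..T} a \<le> integral {0..T} (\<lambda>s. (deriv a s)\<^sup>2 / a s) / 4"
    by (rule o.riccati_comparison[OF T TS da a_pos a_lim a_int q_int q_cont'])
  have "n * K + n * K\<^sup>2 * \<iota> + n * (c T / b T - lam * \<iota>) \<le> phi n K a T"
  proof -
    have "c T / b T - lam * \<iota> = (o.r T * a T - lam * integral {0..T} a) / a T"
      using aT by (simp add: \<iota>_def o.r_def diff_divide_distrib)
    also have "\<dots> \<le> integral {0..T} (\<lambda>s. (deriv a s)\<^sup>2 / a s) / 4 / a T"
      using le aT by (intro divide_right_mono) auto
    finally have "n * (c T / b T - lam * \<iota>) \<le> n * (integral {0..T} (\<lambda>s. (deriv a s)\<^sup>2 / a s) / 4 / a T)"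
      using n by (intro mult_left_mono) auto
    then show ?thesis by (simp add: phi_def \<iota>_def)
  qed
  then have "li_yau (alpha K a T) (phi n K a T) (u T) x
      \<le> li_yau (alpha K a T) (n * K + n * K\<^sup>2 * \<iota> + n * (c T / b T - lam * \<iota>)) (u T) x"
    by (simp add: li_yau_def)
  also have "alpha K a T = 1 + 2 * K * \<iota>" by (simp add: alpha_def \<iota>_def)
  also have "li_yau (1 + 2 * K * \<iota>) (n * K + n * K\<^sup>2 * \<iota> + n * (c T / b T - lam * \<iota>)) (u T) x
      \<le> 2 * n * Dmu * (1 + Dom) * (1 + 2 * K * \<iota>)\<^sup>2 / R"
    using li_yau_oscillator[OF osc T TS cde n K R u_pos du x] by (simp only: eq)
  finally show ?thesis by (simp add: alpha_def \<iota>_def)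
qed

lemma li_yau_eq_deriv:
  assumes u: "\<And>y. u y t > 0" and du: "((\<lambda>s. u x s) has_real_derivative Lap (\<lambda>y. u y t) x) (at t)"
  shows "Gam (\<lambda>y. sqrt (u y t)) (\<lambda>y. sqrt (u y t)) x / u x t
      - al * (deriv (\<lambda>s. sqrt (u x s)) t / sqrt (u x t)) - 1 / 2 * ph
    = 1 / 2 * li_yau al ph (\<lambda>y. u y t) x"
proof -
  have "deriv (\<lambda>s. sqrt (u x s)) t = Lap (\<lambda>y. u y t) x / (2 * sqrt (u x t))"
    by (rule DERIV_imp_deriv) (rule DERIV_sqrt_comp[OF du u])
  moreover have "sqrt (u x t) * sqrt (u x t) = u x t" using u[of x] by simp
  ultimately have "deriv (\<lambda>s. sqrt (u x s)) t / sqrt (u x t) = Lap (\<lambda>y. u y t) x / (2 * u x t)"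
    by (simp add: mult.assoc)
  then show ?thesis using u[of x] by (simp add: li_yau_def field_simps)
qed

end

theorem theorem3p7:
  fixes adj :: "'a \<Rightarrow> 'a \<Rightarrow> bool"
    and w :: "'a \<Rightarrow> 'a \<Rightarrow> real"
    and \<mu> :: "'a \<Rightarrow> real"
    and x\<^sub>0 :: 'a
    and R n K :: real
    and u :: "'a \<Rightarrow> real \<Rightarrow> real"
    and a \<beta> \<eta> :: "real \<Rightarrow> real"
  assumes graph: "weighted_graph adj w \<mu>"
    and R_pos: "R > 0"
    and u_pos: "\<And>x t. u x t > 0"
    and heat: "\<And>x t. x \<in> graph_cball adj x\<^sub>0 (2 * R) \<Longrightarrow>
      ((\<lambda>s. u x s) has_real_derivative laplacian adj w \<mu> (\<lambda>y. u y t) x) (at t)"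
    and n_pos: "n > 0"
    and K_nonneg: "K \<ge> 0"
    and cde: "CDE adj w \<mu> n (- K)"
    and a_diff: "\<And>t. t > 0 \<Longrightarrow> a differentiable (at t)"
    and a_C1: "continuous_on {0<..} (deriv a)"
    and A1_pos: "\<And>t. t > 0 \<Longrightarrow> a t > 0"
    and A1_deriv_pos: "\<And>t. t > 0 \<Longrightarrow> deriv a t > 0"
    and A1_lim: "(a \<longlongrightarrow> 0) (at_right 0)"
    and A1_lim_quot: "((\<lambda>t. a t / deriv a t) \<longlongrightarrow> 0) (at_right 0)"
    and A2_cont: "\<And>L. L > 0 \<Longrightarrow> continuous_on {0<..L} (\<lambda>s. (deriv a s)\<^sup>2 / a s)"
    and A2_int: "\<And>L. L > 0 \<Longrightarrow> (\<lambda>s. (deriv a s)\<^sup>2 / a s) integrable_on {0..L}"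
    and \<beta>_pos: "\<And>t. t > 0 \<Longrightarrow> \<beta> t > 0"
    and \<beta>_diff: "\<And>t. t > 0 \<Longrightarrow> \<beta> differentiable (at t)"
    and \<beta>_ineq: "\<And>t. t > 0 \<Longrightarrow>
      deriv \<beta> t / \<beta> t \<le> 1 / ((alpha K a t)\<^sup>2 * (a t)\<^sup>2) *
        (2 * K * alpha K a t * deriv a t * integral {0..t} a
         + a t / 2 * integral {0..t} (\<lambda>s. (deriv a s)\<^sup>2 / a s)
         - 2 * K\<^sup>2 * a t * integral {0..t} a)"
    and \<eta>_pos: "\<And>T. T > 0 \<Longrightarrow> \<eta> T > 0"
    and \<eta>_bound: "\<And>T t. 0 < t \<Longrightarrow> t \<le> T \<Longrightarrow> \<beta> t \<le> \<eta> T"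
  shows "(\<forall>t>0. \<forall>x \<in> graph_cball adj x\<^sub>0 R.
           gradient_form adj w \<mu> (\<lambda>y. sqrt (u y t)) (\<lambda>y. sqrt (u y t)) x / u x t
             - alpha K a t * (deriv (\<lambda>s. sqrt (u x s)) t / sqrt (u x t))
             - 1/2 * phi n K a t
           \<le> n * D_mu adj w \<mu> * (1 + D_omega adj w) * (alpha K a t)\<^sup>2 * \<eta> t / (R * \<beta> t))
       \<and> ((\<forall>x t. ((\<lambda>s. u x s) has_real_derivative laplacian adj w \<mu> (\<lambda>y. u y t) x) (at t)) \<longrightarrow>
         (\<forall>t>0. \<forall>x.
           gradient_form adj w \<mu> (\<lambda>y. sqrt (u y t)) (\<lambda>y. sqrt (u y t)) x / u x t
             - alpha K a t * (deriv (\<lambda>s. sqrt (u x s)) t / sqrt (u x t))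
           \<le> 1/2 * phi n K a t))"
proof -
  interpret weighted_graph adj w \<mu> by (rule graph)
  \<comment> \<open>Centre and radius are free: the first claim takes \<open>x\<^sub>0\<close> and
    \<open>R\<close>, the second the vertex \<open>x\<close> itself with \<open>\<rho>\<close>
    tending to infinity.\<close>
  have bound: "gradient_form adj w \<mu> (\<lambda>y. sqrt (u y t)) (\<lambda>y. sqrt (u y t)) x / u x t
      - alpha K a t * (deriv (\<lambda>s. sqrt (u x s)) t / sqrt (u x t)) - 1/2 * phi n K a t
      \<le> n * Dmu * (1 + Dom) * (alpha K a t)\<^sup>2 / \<rho>"
    if t: "t > 0" and \<rho>: "\<rho> > 0" and x: "x \<in> graph_cball adj z \<rho>"
      and du: "\<And>y t. y \<in> graph_cball adj z (2 * \<rho>) \<Longrightarrow>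
        ((\<lambda>s. u y s) has_real_derivative laplacian adj w \<mu> (\<lambda>y. u y t) y) (at t)"
    for t x z \<rho>
  proof -
    have x2: "x \<in> graph_cball adj z (2 * \<rho>)"
      using x \<rho> by (auto simp: graph_cball_def elim: order_trans)
    have "li_yau (alpha K a t) (phi n K a t) (\<lambda>y. u y t) x
        \<le> 2 * n * Dmu * (1 + Dom) * (alpha K a t)\<^sup>2 / \<rho>"
      by (rule li_yau_weight[where u="\<lambda>s y. u y s", OF cde n_pos K_nonneg \<rho> t u_pos du x a_diff A1_pos
            A1_deriv_pos A1_lim A2_cont A2_int])
    then show ?thesis
      unfolding li_yau_eq_deriv[of u t x, OF u_pos du[OF x2]] by (simp add: mult_ac)
  qed
  show ?thesis
  proof (intro conjI allI impI ballI)
    fix t :: real and x assume t: "t > 0" and x: "x \<in> graph_cball adj x\<^sub>0 R"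
    let ?C = "n * Dmu * (1 + Dom) * (alpha K a t)\<^sup>2"
    have "0 \<le> Dmu * (1 + Dom)"
      using D_mu_nonneg D_mu_le_D_mu_D_omega by (simp add: distrib_left)
    then have "0 \<le> (n * (alpha K a t)\<^sup>2) * (Dmu * (1 + Dom))" using n_pos by simp
    then have "0 \<le> ?C" by (simp only: mult_ac)
    \<comment> \<open>\<open>\<beta> t \<le> \<eta> t\<close> makes the factor
      \<open>\<eta> t / \<beta> t\<close> at least \<open>1\<close>, and \<open>?C / R\<close> is
      nonnegative.\<close>
    then have "?C / R * 1 \<le> ?C / R * (\<eta> t / \<beta> t)"
      using R_pos \<eta>_bound[OF t order_refl] \<beta>_pos[OF t] by (intro mult_left_mono) auto
    then have "?C / R \<le> ?C * \<eta> t / (R * \<beta> t)" by simp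
    with bound[OF t R_pos x heat]
    show "gradient_form adj w \<mu> (\<lambda>y. sqrt (u y t)) (\<lambda>y. sqrt (u y t)) x / u x t
        - alpha K a t * (deriv (\<lambda>s. sqrt (u x s)) t / sqrt (u x t)) - 1/2 * phi n K a t
        \<le> ?C * \<eta> t / (R * \<beta> t)"
      by (rule order_trans)
  next
    fix t :: real and x
    assume du: "\<forall>x t. ((\<lambda>s. u x s) has_real_derivative laplacian adj w \<mu> (\<lambda>y. u y t) x) (at t)"
      and t: "t > 0"
    let ?C = "n * Dmu * (1 + Dom) * (alpha K a t)\<^sup>2"
    have "((\<lambda>\<rho>. ?C / \<rho>) \<longlongrightarrow> 0) at_top"
      by (rule tendsto_divide_0[OF tendsto_const filterlim_at_top_imp_at_infinity[OF filterlim_ident]])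
    moreover have "\<forall>\<^sub>F \<rho> in at_top. gradient_form adj w \<mu> (\<lambda>y. sqrt (u y t)) (\<lambda>y. sqrt (u y t)) x / u x t
        - alpha K a t * (deriv (\<lambda>s. sqrt (u x s)) t / sqrt (u x t)) - 1/2 * phi n K a t \<le> ?C / \<rho>"
      using eventually_gt_at_top[of 0]
    proof eventually_elim
      case (elim \<rho>)
      have "graph_dist adj x x \<le> enat 0" unfolding graph_dist_le_iff by simp
      then have "x \<in> graph_cball adj x \<rho>"
        using elim by (simp add: graph_cball_def zero_enat_def[symmetric])
      then show ?case using du by (intro bound[OF t elim]) auto
    qed
    ultimately have "gradient_form adj w \<mu> (\<lambda>y. sqrt (u y t)) (\<lambda>y. sqrt (u y t)) x / u x t
        - alpha K a t * (deriv (\<lambda>s. sqrt (u x s)) t / sqrt (u x t)) - 1/2 * phi n K a t \<le> 0"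
      by (rule tendsto_lowerbound) simp
    then show "gradient_form adj w \<mu> (\<lambda>y. sqrt (u y t)) (\<lambda>y. sqrt (u y t)) x / u x t
        - alpha K a t * (deriv (\<lambda>s. sqrt (u x s)) t / sqrt (u x t)) \<le> 1/2 * phi n K a t"
      by simp
  qed
qed

end
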